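(* Let $n\ge 0$ be a fixed integer, let $f_0,\dots,f_n$ be entire functions that are real-valued on the real line, and let $P_n(z)=\sum_{j=0}^n \eta_j f_j(z)$, $z\in\mathbb{C}$, where $\eta_j=\alpha_j+i\beta_j$ and $\alpha_0,\dots,\alpha_n,\beta_0,\dots,\beta_n$ are independent real standard normal random variables. For each Jordan region $\Omega\subset\{z\in\mathbb{C}: K_n(z,z)\neq 0\}$, the expected number of zeros of $P_n$ in $\Omega$ satisfies $$\mathbb{E}[N_n(\Omega)]=\int_{\Omega}h_n(x,y)\,dx\,dy,$$ where, with $z=x+iy$, $$h_n(x,y)=h_n(z)=\frac{K_n^{(1,1)}(z,z)\,K_n(z,z)-\left|K_n^{(0,1)}(z,z)\right|^2}{\pi\left(K_n(z,z)\right)^2}.$$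
   Context: $N_n(\Omega)$ denotes the (random) number of zeros of $P_n$ in $\Omega$, counted with multiplicity. A Jordan region is the bounded region enclosed by a Jordan curve. The kernels are $$K_n(z,w)=\sum_{j=0}^n f_j(z)\overline{f_j(w)},\qquad K_n^{(0,1)}(z,w)=\sum_{j=0}^n f_j(z)\overline{f_j'(w)},\qquad K_n^{(1,1)}(z,w)=\sum_{j=0}^n f_j'(z)\overline{f_j'(w)}.$$ *)

theory Defs
  imports "HOL-Probability.Probability" "HOL-Complex_Analysis.Complex_Analysis"
begin

definition jordan_region :: "complex set \<Rightarrow> bool" where
  "jordan_region \<Omega> \<longleftrightarrow>
     (\<exists>\<gamma>. simple_path \<gamma> \<and> pathfinish \<gamma> = pathstart \<gamma> \<and> \<Omega> = inside (path_image \<gamma>))"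

definition sum_kernel :: "(nat \<Rightarrow> complex \<Rightarrow> complex) \<Rightarrow> nat \<Rightarrow> complex \<Rightarrow> complex \<Rightarrow> complex" where
  "sum_kernel f n z w = (\<Sum>j\<le>n. f j z * cnj (f j w))"

definition sum_kernel01 :: "(nat \<Rightarrow> complex \<Rightarrow> complex) \<Rightarrow> nat \<Rightarrow> complex \<Rightarrow> complex \<Rightarrow> complex" where
  "sum_kernel01 f n z w = (\<Sum>j\<le>n. f j z * cnj (deriv (f j) w))"

definition sum_kernel11 :: "(nat \<Rightarrow> complex \<Rightarrow> complex) \<Rightarrow> nat \<Rightarrow> complex \<Rightarrow> complex \<Rightarrow> complex" where
  "sum_kernel11 f n z w = (\<Sum>j\<le>n. deriv (f j) z * cnj (deriv (f j) w))"

lemma sum_kernel_diag_real: "sum_kernel f n z z \<in> \<real>"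
  unfolding sum_kernel_def complex_norm_square[symmetric] by (intro sum_in_Reals) auto

lemma sum_kernel11_diag_real: "sum_kernel11 f n z z \<in> \<real>"
  unfolding sum_kernel11_def complex_norm_square[symmetric] by (intro sum_in_Reals) auto

text \<open>By the two preceding lemmas, taking real parts here only changes the type.\<close>

definition zero_density :: "(nat \<Rightarrow> complex \<Rightarrow> complex) \<Rightarrow> nat \<Rightarrow> complex \<Rightarrow> real" where
  "zero_density f n z =
     (Re (sum_kernel11 f n z z) * Re (sum_kernel f n z z) - (cmod (sum_kernel01 f n z z))\<^sup>2)
       / (pi * (Re (sum_kernel f n z z))\<^sup>2)"

definition random_sum ::
  "(nat \<Rightarrow> complex \<Rightarrow> complex) \<Rightarrow> nat \<Rightarrow> (nat \<Rightarrow> 'a \<Rightarrow> real) \<Rightarrow> (nat \<Rightarrow> 'a \<Rightarrow> real) \<Rightarrow>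
   'a \<Rightarrow> complex \<Rightarrow> complex" where
  "random_sum f n \<alpha> \<beta> \<omega> z = (\<Sum>j\<le>n. Complex (\<alpha> j \<omega>) (\<beta> j \<omega>) * f j z)"

text \<open>
  The number of zeros of an entire function in a region, counted with multiplicity.
  On a nonempty open set, a finite zero set rules out the zero function, so that
  \<^const>\<open>zorder\<close> is the multiplicity at each zero; the value for the zero function is infinite.
\<close>

definition zero_count :: "(complex \<Rightarrow> complex) \<Rightarrow> complex set \<Rightarrow> ennreal" where
  "zero_count p \<Omega> =
     (if finite {z \<in> \<Omega>. p z = 0}
      then of_nat (\<Sum>z\<in>{z \<in> \<Omega>. p z = 0}. nat (zorder p z)) else \<infinity>)"

end

theory Submission
  imports Defs
begin

text \<open>
  Fix an index \<open>k\<close> for which \<open>f k\<close> is not the zero function, and fix all coefficients except the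
  \<open>k\<close>-th one, \<open>y\<close>. Then \<open>P = y * f k + Q\<close> with \<open>Q\<close> fixed, so away from the zeros of \<open>f k\<close> the zeros
  of \<open>P\<close> are the solutions of \<open>G z = y\<close> for the meromorphic function \<open>G = - Q / f k\<close>. Counting zeros
  thus means counting preimages of a random level under \<open>G\<close>, and the area formula for holomorphic
  maps (\<open>area_formula_holomorphic\<close>), whose Jacobian is \<open>|G'|^2\<close>, turns the average over the Gaussian level
  \<open>y\<close> into the integral over the region of \<open>\<phi>(G z) |G' z|^2\<close>, where \<open>\<phi>\<close> is the density of \<open>y\<close>.
  Two exceptional sets are negligible. Almost every level is not a critical value of \<open>G\<close>, hence all these
  zeros are simple, because the critical values form a countable set. Almost surely \<open>P\<close> does not vanish at
  the finitely many zeros of \<open>f k\<close> in the region, because some other \<open>f j\<close> is nonzero there.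

  For each point \<open>z\<close>, both \<open>G z\<close> and \<open>G' z\<close> are linear in the remaining coefficients. After exchanging
  the integrals, what is left is the expectation of \<open>\<phi>(U) |V|^2\<close> for two jointly Gaussian linear forms
  \<open>U\<close> and \<open>V\<close>. It is computed by integrating out one coefficient at a time
  (\<open>nn_integral_PiM_std_cgauss\<close>): the integrands \<open>cgauss t u * (|v - l * u|^2 + k)\<close> form a class that each
  step preserves. The result is a Gram determinant divided by \<open>pi\<close> times the fourth
  power of a norm. Numerator and denominator scale in the same way when the vector of the \<open>f j\<close> is
  multiplied by a scalar function (\<open>gram_scale\<close>), so dividing by \<open>f k\<close> does not change the quotient,
  and it equals \<open>zero_density\<close>.

  The same scaling invariance gives integrability. The kernel may vanish on the boundary of the region, but a
  common zero of the \<open>f j\<close> can be divided out, which leaves the density unchanged nearby; hence the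
  density is bounded on every bounded set. Measurability of the number of zeros for every outcome, and not
  only almost surely, follows from Rouche's theorem: where \<open>P\<close> is not the zero function, the number of zeros
  in an open set is a lower semicontinuous function of the coefficients.
\<close>

section \<open>Gaussian integrals in the complex plane\<close>

text \<open>
  The parameter is the variance of each of the two real coordinates, so the second absolute
  moment is \<open>2 * s\<close>.
\<close>

definition cgauss :: "real \<Rightarrow> complex \<Rightarrow> real" where
  "cgauss s w = exp (- (cmod w)\<^sup>2 / (2 * s)) / (2 * pi * s)"

text \<open>
  The law of a complex number whose real and imaginary parts are independent standard normal;
  its density is \<open>cgauss 1\<close>, so \<open>E |w|^2 = 2\<close>.
\<close>

definition std_cgauss :: "complex measure" where
  "std_cgauss = density lborel (\<lambda>w. ennreal (cgauss 1 w))"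

lemma cgauss_nonneg: "s > 0 \<Longrightarrow> 0 \<le> cgauss s w"
  by (simp add: cgauss_def)

lemma cgauss_measurable [measurable]: "cgauss s \<in> borel_measurable borel"
  unfolding cgauss_def by measurable

lemma cgauss_eq_normal_density:
  assumes "s > 0"
  shows "cgauss s w = normal_density 0 (sqrt s) (Re w) * normal_density 0 (sqrt s) (Im w)"
  using assms
  by (simp add: cgauss_def normal_density_def cmod_power2 exp_add[symmetric] add_divide_distrib
      diff_divide_distrib flip: real_sqrt_mult)

lemma nn_integral_Re_Im:
  fixes p q :: "real \<Rightarrow> real"
  assumes [measurable]: "p \<in> borel_measurable borel" "q \<in> borel_measurable borel"
    and "\<And>x. 0 \<le> p x" "\<And>x. 0 \<le> q x"
  shows "(\<integral>\<^sup>+w. ennreal (p (Re w) * q (Im w)) \<partial>lborel)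
    = (\<integral>\<^sup>+x. ennreal (p x) \<partial>lborel) * (\<integral>\<^sup>+x. ennreal (q x) \<partial>lborel)"
proof -
  let ?f = "\<lambda>b x. if b = (1::complex) then ennreal (p x) else ennreal (q x)"
  have "(\<integral>\<^sup>+w. (\<Prod>b\<in>Basis. ?f b (w \<bullet> b)) \<partial>lborel) = (\<Prod>b\<in>Basis. (\<integral>\<^sup>+x. ?f b x \<partial>lborel))"
    by (intro nn_integral_lborel_prod) auto
  then show ?thesis
    using assms by (simp add: Basis_complex_def complex_eq_iff inner_complex_def ennreal_mult')
qed

lemma nn_integral_normal_density:
  assumes "\<sigma> > 0"
  shows "(\<integral>\<^sup>+x. ennreal (normal_density 0 \<sigma> x) \<partial>lborel) = 1"
    and "(\<integral>\<^sup>+x. ennreal (normal_density 0 \<sigma> x * x\<^sup>2) \<partial>lborel) = ennreal (\<sigma>\<^sup>2)"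
proof -
  show "(\<integral>\<^sup>+x. ennreal (normal_density 0 \<sigma> x) \<partial>lborel) = 1"
    using assms by (subst nn_integral_eq_integral) auto
  have "integral\<^sup>L lborel (\<lambda>x. normal_density 0 \<sigma> x * (x - 0)^(2 * 1)) = \<sigma>\<^sup>2"
    using assms integral_normal_moment_even[of \<sigma> 0 1] by (simp add: fact_numeral)
  then show "(\<integral>\<^sup>+x. ennreal (normal_density 0 \<sigma> x * x\<^sup>2) \<partial>lborel) = ennreal (\<sigma>\<^sup>2)"
    using integrable_normal_moment[OF assms, of 0 2]
    by (subst nn_integral_eq_integral) (auto simp: assms)
qed

lemma nn_integral_cgauss:
  assumes "s > 0"
  shows "(\<integral>\<^sup>+w. ennreal (cgauss s w) \<partial>lborel) = 1"
  unfolding cgauss_eq_normal_density[OF assms]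
  using assms by (subst nn_integral_Re_Im) (auto simp: nn_integral_normal_density)

lemma nn_integral_cgauss_norm2:
  assumes "s > 0"
  shows "(\<integral>\<^sup>+w. ennreal (cgauss s w * (cmod w)\<^sup>2) \<partial>lborel) = ennreal (2 * s)"
proof -
  let ?N = "normal_density 0 (sqrt s)"
  have split: "ennreal (cgauss s w * (cmod w)\<^sup>2)
      = ennreal ((?N (Re w) * (Re w)\<^sup>2) * ?N (Im w)) + ennreal (?N (Re w) * (?N (Im w) * (Im w)\<^sup>2))" for w
    by (subst ennreal_plus[symmetric])
       (auto simp: cgauss_eq_normal_density[OF assms] cmod_power2 algebra_simps)
  moreover have "(\<integral>\<^sup>+w. ennreal ((?N (Re w) * (Re w)\<^sup>2) * ?N (Im w)) \<partial>lborel) = ennreal s"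
    using assms nn_integral_Re_Im[of "\<lambda>x. ?N x * x\<^sup>2" ?N] by (simp add: nn_integral_normal_density)
  moreover have "(\<integral>\<^sup>+w. ennreal (?N (Re w) * (?N (Im w) * (Im w)\<^sup>2)) \<partial>lborel) = ennreal s"
    using assms nn_integral_Re_Im[of ?N "\<lambda>x. ?N x * x\<^sup>2"] by (simp add: nn_integral_normal_density)
  ultimately show ?thesis
    unfolding split using assms by (subst nn_integral_add) (auto simp flip: ennreal_plus)
qed

lemma prob_space_std_cgauss: "prob_space std_cgauss"
  by (rule prob_spaceI) (simp add: std_cgauss_def emeasure_density nn_integral_cgauss)

lemma sets_std_cgauss [measurable_cong, simp]: "sets std_cgauss = sets borel"
  and space_std_cgauss [simp]: "space std_cgauss = UNIV"
  by (simp_all add: std_cgauss_def)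

lemma nn_integral_lborel_uminus:
  fixes h :: "complex \<Rightarrow> ennreal"
  assumes [measurable]: "h \<in> borel_measurable borel"
  shows "(\<integral>\<^sup>+w. h (- w) \<partial>lborel) = (\<integral>\<^sup>+w. h w \<partial>lborel)"
proof -
  have "(lborel :: complex measure) = distr lborel borel uminus"
    using lborel_affine[of "-1" "0::complex"] by (simp add: density_1)
  then have "(\<integral>\<^sup>+w. h w \<partial>lborel) = (\<integral>\<^sup>+w. h w \<partial>(distr lborel borel uminus))" by simp
  also have "\<dots> = (\<integral>\<^sup>+w. h (- w) \<partial>lborel)" by (subst nn_integral_distr) auto
  finally show ?thesis by simp
qed

lemma nn_integral_lborel_translate:
  fixes h :: "complex \<Rightarrow> ennreal"
  assumes [measurable]: "h \<in> borel_measurable borel"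
  shows "(\<integral>\<^sup>+w. h (m + w) \<partial>lborel) = (\<integral>\<^sup>+w. h w \<partial>lborel)"
proof -
  have "(\<integral>\<^sup>+w. h w \<partial>lborel) = (\<integral>\<^sup>+w. h w \<partial>(distr lborel borel ((+) m)))"
    by (simp add: lborel_distr_plus)
  also have "\<dots> = (\<integral>\<^sup>+w. h (m + w) \<partial>lborel)" by (subst nn_integral_distr) auto
  finally show ?thesis by simp
qed

text \<open>
  Averaging over \<open>w\<close> and \<open>- w\<close> removes the cross term of \<open>|p + w * q|^2\<close> by the parallelogram
  law; this avoids splitting a signed integrand into parts.
\<close>

lemma nn_integral_cgauss_affine:
  assumes "s > 0" "k \<ge> 0"
  shows "(\<integral>\<^sup>+w. ennreal (cgauss s w * ((cmod (p + w * q))\<^sup>2 + k)) \<partial>lborel)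
     = ennreal ((cmod p)\<^sup>2 + 2 * s * (cmod q)\<^sup>2 + k)"
proof -
  let ?I = "\<lambda>q. \<integral>\<^sup>+w. ennreal (cgauss s w * ((cmod (p + w * q))\<^sup>2 + k)) \<partial>lborel"
  note nn = cgauss_nonneg[OF assms(1)]
  have sym: "?I q = (\<integral>\<^sup>+w. ennreal (cgauss s w * ((cmod (p - w * q))\<^sup>2 + k)) \<partial>lborel)"
    by (subst nn_integral_lborel_uminus[symmetric]) (auto simp: cgauss_def)
  have "?I q + ?I q = (\<integral>\<^sup>+w. ennreal (cgauss s w * ((cmod (p + w * q))\<^sup>2 + k))
      + ennreal (cgauss s w * ((cmod (p - w * q))\<^sup>2 + k)) \<partial>lborel)"
    by (subst (2) sym, subst nn_integral_add) auto
  also have "\<dots> = (\<integral>\<^sup>+w. ennreal (2 * ((cmod p)\<^sup>2 + k)) * ennreal (cgauss s w)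
      + ennreal (2 * (cmod q)\<^sup>2) * ennreal (cgauss s w * (cmod w)\<^sup>2) \<partial>lborel)"
  proof (intro nn_integral_cong)
    fix w
    have "(cmod (p + w * q))\<^sup>2 + (cmod (p - w * q))\<^sup>2 = 2 * (cmod p)\<^sup>2 + 2 * ((cmod w)\<^sup>2 * (cmod q)\<^sup>2)"
      unfolding cmod_power2 by (simp add: algebra_simps power2_eq_square)
    then have "cgauss s w * (((cmod (p + w * q))\<^sup>2 + (cmod (p - w * q))\<^sup>2) + 2 * k)
      = cgauss s w * ((2 * (cmod p)\<^sup>2 + 2 * ((cmod w)\<^sup>2 * (cmod q)\<^sup>2)) + 2 * k)"
      by (simp only:)
    then have *: "cgauss s w * ((cmod (p + w * q))\<^sup>2 + k) + cgauss s w * ((cmod (p - w * q))\<^sup>2 + k)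
      = 2 * ((cmod p)\<^sup>2 + k) * cgauss s w + 2 * (cmod q)\<^sup>2 * (cgauss s w * (cmod w)\<^sup>2)"
      by (simp add: algebra_simps)
    show "ennreal (cgauss s w * ((cmod (p + w * q))\<^sup>2 + k))
      + ennreal (cgauss s w * ((cmod (p - w * q))\<^sup>2 + k))
      = ennreal (2 * ((cmod p)\<^sup>2 + k)) * ennreal (cgauss s w)
      + ennreal (2 * (cmod q)\<^sup>2) * ennreal (cgauss s w * (cmod w)\<^sup>2)"
      using assms nn by (simp add: ennreal_mult[symmetric] ennreal_plus[symmetric] * del: ennreal_plus)
  qed
  also have "\<dots> = ennreal (2 * ((cmod p)\<^sup>2 + k)) + ennreal (2 * (cmod q)\<^sup>2) * ennreal (2 * s)"
    using assms by (simp add: nn_integral_add nn_integral_cmult nn_integral_cgauss nn_integral_cgauss_norm2)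
  also have "\<dots> = 2 * ennreal ((cmod p)\<^sup>2 + 2 * s * (cmod q)\<^sup>2 + k)"
  proof -
    have "ennreal (2 * ((cmod p)\<^sup>2 + k)) + ennreal (2 * (cmod q)\<^sup>2) * ennreal (2 * s)
        = ennreal (2 * ((cmod p)\<^sup>2 + k) + (2 * (cmod q)\<^sup>2) * (2 * s))"
      using assms by (subst ennreal_mult'[symmetric], simp, subst ennreal_plus[symmetric]) auto
    also have "2 * ((cmod p)\<^sup>2 + k) + (2 * (cmod q)\<^sup>2) * (2 * s)
        = 2 * ((cmod p)\<^sup>2 + 2 * s * (cmod q)\<^sup>2 + k)"
      by (simp add: algebra_simps)
    finally show ?thesis by (simp only: ennreal_mult'[of 2] ennreal_numeral zero_le_numeral)
  qed
  finally have "2 * ?I q = 2 * ennreal ((cmod p)\<^sup>2 + 2 * s * (cmod q)\<^sup>2 + k)"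
    unfolding mult_2[of "?I q"] .
  then show ?thesis by (simp add: ennreal_mult_cancel_left)
qed

text \<open>
  The algebraic identities behind one step of Gaussian integration. The letters \<open>A\<close>, \<open>B\<close>, \<open>U\<close>,
  \<open>W\<close> stand for the conjugates of \<open>a\<close>, \<open>b\<close>, \<open>u\<close>, \<open>w\<close> and \<open>Y\<close> for that of \<open>X\<close>; treating them as
  independent variables makes each identity one between rational functions.
\<close>

context
  fixes a A t T :: complex
  assumes T: "T = t + a * A" and T_nonzero: "T \<noteq> 0" and t_nonzero: "t \<noteq> 0"
begin

lemma shifted_affine_identity: "u + (w - A * u / T) * a = u * (t / T) + w * a"
  using T_nonzero t_nonzero by (simp add: divide_simps) (use T in algebra)

lemma regression_update_identity:
  "v + (w - A * u / T) * b - X / t * (u * (t / T) + w * a)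
    = (v - (X + A * b) / T * u) + w * (b - X / t * a)"
  using T_nonzero t_nonzero by (simp add: divide_simps) algebra

lemma gram_update_identity:
  "G + b * B - (X + A * b) * (Y + a * B) / T
    = G - X * Y / t + t / T * ((b - X / t * a) * (B - Y / t * A))"
proof -
  have "t * T * (G + b * B - (X + A * b) * (Y + a * B) / T)
      = t * T * (G - X * Y / t + t / T * ((b - X / t * a) * (B - Y / t * A)))"
    using T_nonzero t_nonzero by (simp add: divide_simps) (use T in algebra)
  then show ?thesis using T_nonzero t_nonzero by simp
qed

lemma complete_square_identity:
  "(w - A*u/T)*(W - a*U/T) + (u*(t/T)+w*a)*(U*(t/T)+W*A)/t = u*U/T + w*W*T/t"
proof -
  have "((w - A*u/T)*(W - a*U/T) + (u*(t/T)+w*a)*(U*(t/T)+W*A)/t) * (t*T^2)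
      = ((w*T - A*u)*(W*T - a*U))*t + (u*t+w*a*T)*(U*t+W*A*T)"
    using T_nonzero t_nonzero by (simp add: divide_simps) algebra
  also have "\<dots> = u*U*t*T + w*W*T^3" unfolding T by algebra
  also have "\<dots> = (u*U/T + w*W*T/t) * (t*T^2)" using T_nonzero t_nonzero by (simp add: divide_simps) algebra
  finally show ?thesis using T_nonzero t_nonzero by simp
qed

end

text \<open>
  The quadratic form in the product of the density of \<open>c\<close> and that of \<open>u + c * a\<close> is completed
  to a square in \<open>c\<close>, which separates the marginal law of \<open>u\<close> from the conditional law of \<open>c\<close>,
  centred at \<open>- cnj a * u / t'\<close> with variance \<open>t / t'\<close>.
\<close>

lemma cgauss_product:
  fixes a u w :: complex and t :: real
  assumes "t > 0"
  defines "t' \<equiv> t + (cmod a)\<^sup>2"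
  shows "cgauss 1 (w - cnj a * u / t') * cgauss t (u + (w - cnj a * u / t') * a)
    = cgauss t' u * cgauss (t / t') w"
proof -
  have t': "t' > 0" using assms by (simp add: add_pos_nonneg)
  have cm: "complex_of_real t' = t + a * cnj a" 
    unfolding t'_def of_real_add complex_norm_square ..
  have ne: "complex_of_real t' \<noteq> 0" "complex_of_real t \<noteq> 0" using t' assms(1) by auto
  let ?m = "cnj a * u / t'"
  have "(cmod (w - ?m))\<^sup>2 + (cmod (u + (w - ?m) * a))\<^sup>2 / t
     = (cmod u)\<^sup>2 / t' + (cmod w)\<^sup>2 * t' / t" (is "?L = ?R")
  proof -
    have e: "u + (w - ?m) * a = u * (t / t') + w * a"
      unfolding of_real_divide by (rule shifted_affine_identity[OF cm ne])
    have "complex_of_real ?L = (w - ?m) * (cnj w - a * cnj u / t')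
        + (u * (t / t') + w * a) * (cnj u * (t / t') + cnj w * cnj a) / t"
      unfolding e by (simp only: of_real_add of_real_divide complex_norm_square) simp
    also have "\<dots> = complex_of_real ?R"
      unfolding of_real_divide complete_square_identity[OF cm ne]
      by (simp only: of_real_add of_real_divide of_real_mult complex_norm_square)
    finally show ?thesis by (simp only: of_real_eq_iff)
  qed
  moreover have "- x / 2 + - y / (2 * t) = - (x + y / t) / 2" for x y
    by (simp add: add_divide_distrib)
  moreover have "- x / (2 * t') + - y / (2 * (t / t')) = - (x / t' + y * t' / t) / 2" for x y
    by (simp add: add_divide_distrib)
  ultimately have E: "- (cmod (w - ?m))\<^sup>2 / 2 + - (cmod (u + (w - ?m) * a))\<^sup>2 / (2 * t)
     = - (cmod u)\<^sup>2 / (2 * t') + - (cmod w)\<^sup>2 / (2 * (t / t'))"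
    by (simp only:)
  have "cgauss 1 (w - ?m) * cgauss t (u + (w - ?m) * a)
     = exp (- (cmod (w - ?m))\<^sup>2 / 2 + - (cmod (u + (w - ?m) * a))\<^sup>2 / (2 * t)) / (4 * pi^2 * t)"
    unfolding cgauss_def exp_add by (simp add: power2_eq_square)
  also have "\<dots> = cgauss t' u * cgauss (t / t') w"
    unfolding cgauss_def E exp_add using t' by (simp add: power2_eq_square)
  finally show ?thesis .
qed

text \<open>
  One coefficient \<open>c\<close> is integrated out. Here \<open>t\<close> is the variance accumulated by the first
  linear form, starting from 1 for the density \<open>cgauss 1\<close> itself, and \<open>X\<close> is its covariance with
  the second one, so \<open>X / t\<close> is the regression coefficient of \<open>v\<close> on \<open>u\<close>; the integrand keeps
  its shape with updated \<open>t\<close>, \<open>X\<close> and residual variance \<open>k\<close>.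
\<close>

lemma std_cgauss_step:
  fixes a b u v X :: complex and t k :: real
  assumes "t > 0" "k \<ge> 0"
  defines "t' \<equiv> t + (cmod a)\<^sup>2"
  defines "X' \<equiv> X + cnj a * b"
  shows "(\<integral>\<^sup>+c. ennreal (cgauss t (u + c * a) * ((cmod (v + c * b - X / t * (u + c * a)))\<^sup>2 + k)) \<partial>std_cgauss)
     = ennreal (cgauss t' u * ((cmod (v - X' / t' * u))\<^sup>2 + (k + 2 * (t / t') * (cmod (b - X / t * a))\<^sup>2)))"
proof -
  have t': "t' > 0" using assms by (simp add: add_pos_nonneg)
  have cm: "complex_of_real t' = t + a * cnj a" 
    unfolding t'_def of_real_add complex_norm_square ..
  let ?m = "cnj a * u / t'" and ?q = "b - X / t * a" and ?p = "v - X' / t' * u"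
  have regroup: "ennreal x * ennreal (y * z) = ennreal c * ennreal (d * z)"
    if "x * y = c * d" "0 \<le> x" "0 \<le> c" for x y z c d :: real
  proof -
    have "ennreal x * ennreal (y * z) = ennreal (x * y * z)"
      using that(2) by (simp only: ennreal_mult'[symmetric] mult.assoc)
    also have "\<dots> = ennreal c * ennreal (d * z)"
      unfolding that(1) using that(3) by (simp only: ennreal_mult'[symmetric] mult.assoc)
    finally show ?thesis .
  qed
  let ?h = "\<lambda>c. ennreal (cgauss 1 c) * ennreal (cgauss t (u + c * a) * ((cmod (v + c * b - X / t * (u + c * a)))\<^sup>2 + k))"
  note nn = cgauss_nonneg
  have "(\<integral>\<^sup>+c. ennreal (cgauss t (u + c * a) * ((cmod (v + c * b - X / t * (u + c * a)))\<^sup>2 + k)) \<partial>std_cgauss)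
    = (\<integral>\<^sup>+c. ?h c \<partial>lborel)"
    unfolding std_cgauss_def by (subst nn_integral_density) auto
  \<comment> \<open>Recentring at the conditional mean \<open>- ?m\<close> of \<open>c\<close> given \<open>u\<close>.\<close>
  also have "\<dots> = (\<integral>\<^sup>+w. ?h (- ?m + w) \<partial>lborel)"
    by (rule nn_integral_lborel_translate[symmetric]) simp
  also have "\<dots> = (\<integral>\<^sup>+w. ennreal (cgauss t' u) * ennreal (cgauss (t / t') w * ((cmod (?p + w * ?q))\<^sup>2 + k)) \<partial>lborel)"
  proof (intro nn_integral_cong)
    fix w
    have e: "- ?m + w = w - ?m" by simp
    have lin: "v + (w - ?m) * b - X / t * (u + (w - ?m) * a) = ?p + w * ?q"
    proof -
      have ne: "complex_of_real t' \<noteq> 0" "complex_of_real t \<noteq> 0" using t' assms(1) by auto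
      have e: "u + (w - ?m) * a = u * (t / t') + w * a"
        unfolding of_real_divide by (rule shifted_affine_identity[OF cm ne])
      show ?thesis
        unfolding e X'_def of_real_divide by (rule regression_update_identity[OF cm ne])
    qed
    show "?h (- ?m + w) = ennreal (cgauss t' u) * ennreal (cgauss (t / t') w * ((cmod (?p + w * ?q))\<^sup>2 + k))"
      unfolding e lin
    proof (rule regroup)
      show "cgauss 1 (w - ?m) * cgauss t (u + (w - ?m) * a) = cgauss t' u * cgauss (t / t') w"
        unfolding t'_def by (rule cgauss_product[OF assms(1)])
    qed (rule nn, simp, rule nn, rule t')
  qed
  also have "\<dots> = ennreal (cgauss t' u) * ennreal ((cmod ?p)\<^sup>2 + 2 * (t / t') * (cmod ?q)\<^sup>2 + k)"
  proof -
    have "t / t' > 0" using assms(1) t' by simp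
    note affine = nn_integral_cgauss_affine[OF this assms(2), of ?p ?q]
    show ?thesis unfolding affine[symmetric] by (rule nn_integral_cmult) measurable
  qed
  also have "\<dots> = ennreal (cgauss t' u * ((cmod ?p)\<^sup>2 + (k + 2 * (t / t') * (cmod ?q)\<^sup>2)))"
    using nn[OF t'] by (subst ennreal_mult'[symmetric]) (simp_all only: add.assoc add.commute[of k])
  finally show ?thesis .
qed

lemma product_sigma_finite_std_cgauss: "product_sigma_finite (\<lambda>_. std_cgauss)"
  unfolding product_sigma_finite_def
  using prob_space_imp_sigma_finite[OF prob_space_std_cgauss] by simp

text \<open>
  Half the residual variance \<open>k\<close> accumulated by \<open>std_cgauss_step\<close> has the closed form
  \<open>B - |X|^2 / t\<close>.
\<close>

lemma gram_update:
  fixes X a b :: complex and t B :: real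
  assumes "t > 0"
  defines "t' \<equiv> t + (cmod a)\<^sup>2"
  shows "B + (cmod b)\<^sup>2 - (cmod (X + cnj a * b))\<^sup>2 / t'
    = B - (cmod X)\<^sup>2 / t + (t / t') * (cmod (b - X / t * a))\<^sup>2"
proof -
  have t': "t' > 0" using assms by (simp add: add_pos_nonneg)
  have cm: "complex_of_real t' = t + a * cnj a" 
    unfolding t'_def of_real_add complex_norm_square ..
  have ne: "complex_of_real t' \<noteq> 0" "complex_of_real t \<noteq> 0" using t' assms(1) by auto
  let ?L = "B + b * cnj b - (X + cnj a * b) * (cnj X + a * cnj b) / t'"
  let ?R = "B - X * cnj X / t + t / t' * ((b - X / t * a) * (cnj b - cnj X / t * cnj a))"
  have "?L = ?R" unfolding of_real_divide by (rule gram_update_identity[OF cm ne])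
  then have "complex_of_real (B + (cmod b)\<^sup>2 - (cmod (X + cnj a * b))\<^sup>2 / t')
    = complex_of_real (B - (cmod X)\<^sup>2 / t + (t / t') * (cmod (b - X / t * a))\<^sup>2)"
    by (simp only: of_real_add of_real_diff of_real_divide of_real_mult complex_norm_square) simp
  then show ?thesis by (simp only: of_real_eq_iff)
qed

text \<open>
  Induction on the index set by \<open>std_cgauss_step\<close>. The free offsets \<open>u\<close> and \<open>v\<close> are what makes
  the induction work: they absorb the contribution of the coefficient that is integrated last.
  The first conjunct supplies the nonnegativity of the residual variance that the next step
  needs.
\<close>

lemma nn_integral_PiM_std_cgauss_aux:
  fixes a b :: "'i \<Rightarrow> complex"
  assumes "finite I"
  defines "T \<equiv> 1 + (\<Sum>j\<in>I. (cmod (a j))\<^sup>2)"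
  defines "X \<equiv> \<Sum>j\<in>I. cnj (a j) * b j"
  defines "B \<equiv> \<Sum>j\<in>I. (cmod (b j))\<^sup>2"
  shows "B - (cmod X)\<^sup>2 / T \<ge> 0 \<and> (\<integral>\<^sup>+c. ennreal (cgauss 1 (u + (\<Sum>j\<in>I. c j * a j)) * (cmod (v + (\<Sum>j\<in>I. c j * b j)))\<^sup>2)
            \<partial>(PiM I (\<lambda>_. std_cgauss)))
     = ennreal (cgauss T u * ((cmod (v - X / T * u))\<^sup>2 + 2 * (B - (cmod X)\<^sup>2 / T)))"
  using assms(1) unfolding T_def X_def B_def
proof (induction I arbitrary: u v)
  case empty
  interpret product_sigma_finite "\<lambda>_. std_cgauss" by (rule product_sigma_finite_std_cgauss)
  show ?case by (simp add: PiM_empty nn_integral_count_space_finite)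
next
  case (insert i I)
  interpret product_sigma_finite "\<lambda>_. std_cgauss" by (rule product_sigma_finite_std_cgauss)
  let ?T = "\<lambda>I. 1 + (\<Sum>j\<in>I. (cmod (a j))\<^sup>2)" and ?X = "\<lambda>I. \<Sum>j\<in>I. cnj (a j) * b j"
  let ?B = "\<lambda>I. \<Sum>j\<in>I. (cmod (b j))\<^sup>2"
  let ?K = "\<lambda>I. ?B I - (cmod (?X I))\<^sup>2 / ?T I"
  have T: "?T I > 0" by (intro add_pos_nonneg sum_nonneg) auto
  have T': "?T (insert i I) = ?T I + (cmod (a i))\<^sup>2" using insert.hyps by (simp add: ac_simps)
  have X': "?X (insert i I) = ?X I + cnj (a i) * b i" using insert.hyps by (simp add: ac_simps)
  have K': "?K (insert i I) = ?K I + (?T I / ?T (insert i I)) * (cmod (b i - ?X I / ?T I * a i))\<^sup>2"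
    using gram_update[OF T, of "?B I" "b i" "?X I" "a i"] unfolding T' X' using insert.hyps
    by (simp add: ac_simps)
  have K2: "2 * (?B (insert i I) - (cmod (?X I + cnj (a i) * b i))\<^sup>2 / (?T I + (cmod (a i))\<^sup>2))
      = 2 * ?K I + 2 * (?T I / (?T I + (cmod (a i))\<^sup>2)) * (cmod (b i - ?X I / ?T I * a i))\<^sup>2"
    using K' unfolding T' X' by (simp only: distrib_left mult.assoc)
  have Kpos: "?K I \<ge> 0" using insert.IH by blast
  have s: "(\<Sum>j\<in>insert i I. (x(i := y)) j * d j) = y * d i + (\<Sum>j\<in>I. x j * d j)" for x y d
  proof -
    have "(\<Sum>j\<in>I. (x(i := y)) j * d j) = (\<Sum>j\<in>I. x j * d j)"
      using insert.hyps by (intro sum.cong) auto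
    then show ?thesis using insert.hyps by simp
  qed
  have "(\<integral>\<^sup>+c. ennreal (cgauss 1 (u + (\<Sum>j\<in>insert i I. c j * a j)) * (cmod (v + (\<Sum>j\<in>insert i I. c j * b j)))\<^sup>2)
            \<partial>(PiM (insert i I) (\<lambda>_. std_cgauss)))
     = (\<integral>\<^sup>+y. (\<integral>\<^sup>+x. ennreal (cgauss 1 ((u + y * a i) + (\<Sum>j\<in>I. x j * a j)) * (cmod ((v + y * b i) + (\<Sum>j\<in>I. x j * b j)))\<^sup>2)
            \<partial>(PiM I (\<lambda>_. std_cgauss))) \<partial>std_cgauss)"
    by (subst product_nn_integral_insert_rev[OF insert.hyps]) (measurable, simp only: s add.assoc)
  also have "\<dots> = (\<integral>\<^sup>+y. ennreal (cgauss (?T I) (u + y * a i) * ((cmod (v + y * b i - ?X I / ?T I * (u + y * a i)))\<^sup>2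
           + 2 * ?K I)) \<partial>std_cgauss)"
    using insert.IH by (intro nn_integral_cong) blast
  also have "\<dots> = ennreal (cgauss (?T (insert i I)) u *
      ((cmod (v - ?X (insert i I) / ?T (insert i I) * u))\<^sup>2 + 2 * ?K (insert i I)))"
    unfolding T' X'
  proof (subst K2, rule std_cgauss_step[OF T])
    show "0 \<le> 2 * ?K I" using Kpos by simp
  qed
  finally have 1: "(\<integral>\<^sup>+c. ennreal (cgauss 1 (u + (\<Sum>j\<in>insert i I. c j * a j)) * (cmod (v + (\<Sum>j\<in>insert i I. c j * b j)))\<^sup>2)
            \<partial>(PiM (insert i I) (\<lambda>_. std_cgauss))) = \<dots>" .
  have "?T I + (cmod (a i))\<^sup>2 \<ge> 0" using T by (simp add: add_nonneg_nonneg)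
  then have "(?T I / (?T I + (cmod (a i))\<^sup>2)) * (cmod (b i - ?X I / ?T I * a i))\<^sup>2 \<ge> 0"
    using T by (intro mult_nonneg_nonneg divide_nonneg_nonneg) auto
  then have "?K (insert i I) \<ge> 0" using Kpos K'[unfolded T'] unfolding T' by linarith
  with 1 show ?case by blast
qed

lemma nn_integral_PiM_std_cgauss:
  fixes a b :: "'i \<Rightarrow> complex"
  assumes "finite I"
  defines "s \<equiv> \<Sum>j\<in>I. (cmod (a j))\<^sup>2"
  shows "(\<integral>\<^sup>+c. ennreal (cgauss 1 (\<Sum>j\<in>I. c j * a j) * (cmod (\<Sum>j\<in>I. c j * b j))\<^sup>2) \<partial>(PiM I (\<lambda>_. std_cgauss)))
     = ennreal (((1 + s) * (\<Sum>j\<in>I. (cmod (b j))\<^sup>2) - (cmod (\<Sum>j\<in>I. cnj (a j) * b j))\<^sup>2) / (pi * (1 + s)\<^sup>2))"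
proof -
  have "1 + s > 0" unfolding s_def by (intro add_pos_nonneg sum_nonneg) auto
  then have "2 * (B - x / (1 + s)) / (2 * pi * (1 + s)) = ((1 + s) * B - x) / (pi * (1 + s)\<^sup>2)" for B x
    by (simp add: divide_simps power2_eq_square algebra_simps)
  then show ?thesis
    using nn_integral_PiM_std_cgauss_aux[OF assms(1), of b a 0 0] unfolding s_def[symmetric]
    by (simp add: cgauss_def)
qed

section \<open>The area formula for holomorphic maps\<close>

text \<open>
  These maps identify the complex plane with \<open>real^2\<close>, where the Jacobian is the determinant of
  a matrix.
\<close>

abbreviation vec_to_complex :: "real^2 \<Rightarrow> complex" where
  "vec_to_complex v \<equiv> Complex (v $ 1) (v $ 2)"

abbreviation complex_to_vec :: "complex \<Rightarrow> real^2" where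
  "complex_to_vec z \<equiv> vector [Re z, Im z]"

lemma vec_to_complex_inverse [simp]: "complex_to_vec (vec_to_complex v) = v"
  by (simp add: vec_eq_iff forall_2 vector_2)

lemma complex_to_vec_inverse [simp]: "vec_to_complex (complex_to_vec z) = z"
  by (simp add: vector_2 complex_eq_iff)

lemma bounded_linear_vec_to_complex: "bounded_linear vec_to_complex"
  by (intro linear_conv_bounded_linear[THEN iffD1] linearI) (auto simp: complex_eq_iff)

lemma bounded_linear_complex_to_vec: "bounded_linear complex_to_vec"
  by (intro linear_conv_bounded_linear[THEN iffD1] linearI) (auto simp: vec_eq_iff forall_2 vector_2)

lemma measurable_vec_to_complex [measurable]: "vec_to_complex \<in> borel_measurable borel"
  by (intro borel_measurable_continuous_onI linear_continuous_on bounded_linear_vec_to_complex)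

lemma Basis_real2: "(Basis :: (real^2) set) = {axis 1 1, axis 2 1}"
  by (auto simp: Basis_vec_def exhaust_2) (metis exhaust_2)

lemma distr_lborel_vec_to_complex: "distr lborel borel vec_to_complex = lborel"
proof (rule lborel_eqI[symmetric])
  fix l u :: complex
  assume le: "\<And>b. b \<in> Basis \<Longrightarrow> l \<bullet> b \<le> u \<bullet> b"
  have "vec_to_complex -` box l u = box (complex_to_vec l) (complex_to_vec u)"
    by (auto simp: box_def Basis_real2 Basis_complex_def inner_complex_def inner_axis vector_2)
  moreover have "Re l \<le> Re u" "Im l \<le> Im u"
    using le[of 1] le[of \<i>] by (auto simp: Basis_complex_def inner_complex_def)
  ultimately show "emeasure (distr lborel borel vec_to_complex) (box l u) = (\<Prod>b\<in>Basis. (u - l) \<bullet> b)"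
    by (simp add: emeasure_distr emeasure_lborel_box_eq Basis_real2 Basis_complex_def
        inner_complex_def inner_axis vector_2 axis_eq_axis complex_eq_iff)
qed simp

text \<open>
  As a real linear map, multiplication by \<open>d\<close> on the plane has determinant \<open>|d|^2\<close>. Boundedness
  of the image makes its measure finite, so that the change of variables theorem yields the
  integral without a separate integrability check.
\<close>

lemma emeasure_holomorphic_image:
  fixes f f' :: "complex \<Rightarrow> complex"
  assumes [measurable]: "S \<in> sets borel" "f ` S \<in> sets borel" "f' \<in> borel_measurable borel"
    and deriv: "\<And>z. z \<in> S \<Longrightarrow> (f has_field_derivative f' z) (at z)"
    and inj: "inj_on f S" and bnd: "bounded (f ` S)"
  shows "emeasure lborel (f ` S) = (\<integral>\<^sup>+z\<in>S. ennreal ((cmod (f' z))\<^sup>2) \<partial>lborel)"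
proof -
  define V where "V = vec_to_complex -` S"
  define g where "g = complex_to_vec \<circ> f \<circ> vec_to_complex"
  define g' where "g' v h = complex_to_vec (f' (vec_to_complex v) * vec_to_complex h)" for v h
  have transfer: "emeasure lborel (vec_to_complex -` A) = emeasure lborel A" if "A \<in> sets borel" for A
    using emeasure_distr[OF _ , of vec_to_complex lborel borel A] that distr_lborel_vec_to_complex by simp
  have V: "V \<in> sets borel" unfolding V_def using measurable_sets[OF measurable_vec_to_complex assms(1)] by simp
  have gV: "g ` V = vec_to_complex -` (f ` S)"
  proof (intro equalityI subsetI)
    fix v assume "v \<in> vec_to_complex -` (f ` S)"
    then obtain z where z: "z \<in> S" "vec_to_complex v = f z" by auto
    then have "complex_to_vec z \<in> V" "g (complex_to_vec z) = v"
      unfolding V_def g_def using vec_to_complex_inverse[of v] by (auto simp del: vec_to_complex_inverse)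
    then show "v \<in> g ` V" by blast
  qed (auto simp: V_def g_def)
  have gV_meas: "g ` V \<in> sets borel"
    unfolding gV using measurable_sets[OF measurable_vec_to_complex assms(2)] by simp
  have fin: "emeasure lborel (f ` S) < \<infinity>"
    using emeasure_bounded_finite[OF bnd] by simp
  have eqs: "emeasure lebesgue (g ` V) = emeasure lborel (f ` S)"
    using gV_meas gV transfer[OF assms(2)] by simp
  have lm: "g ` V \<in> lmeasurable"
    using gV_meas eqs fin by (intro fmeasurableI) auto
  have der: "(g has_derivative g' v) (at v within V)" if "v \<in> V" for v
  proof -
    have "(f has_derivative (*) (f' (vec_to_complex v))) (at (vec_to_complex v))"
      using deriv[of "vec_to_complex v"] that by (simp add: V_def has_field_derivative_def)
    then have "(f \<circ> vec_to_complex has_derivative ((*) (f' (vec_to_complex v)) \<circ> vec_to_complex)) (at v)"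
      by (rule diff_chain_at[OF bounded_linear_imp_has_derivative[OF bounded_linear_vec_to_complex]])
    then have "(complex_to_vec \<circ> (f \<circ> vec_to_complex) has_derivative
        complex_to_vec \<circ> ((*) (f' (vec_to_complex v)) \<circ> vec_to_complex)) (at v)"
      by (rule diff_chain_at) (intro bounded_linear_imp_has_derivative bounded_linear_complex_to_vec)
    then show ?thesis
      unfolding g_def g'_def comp_assoc by (auto simp: comp_def intro: has_derivative_at_withinI)
  qed
  have det: "\<bar>det (matrix (g' v))\<bar> = (cmod (f' (vec_to_complex v)))\<^sup>2" for v
    unfolding cmod_power2 by (simp add: det_2 matrix_def g'_def vector_2 axis_def power2_eq_square)
  have inj': "inj_on g V"
  proof (rule inj_onI)
    fix x y assume "x \<in> V" "y \<in> V" "g x = g y"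
    then have "f (vec_to_complex x) = f (vec_to_complex y)"
      unfolding g_def comp_def by (metis complex_to_vec_inverse)
    with \<open>x \<in> V\<close> \<open>y \<in> V\<close> have "vec_to_complex x = vec_to_complex y"
      using inj by (auto simp: V_def inj_on_def)
    then show "x = y" by (metis vec_to_complex_inverse)
  qed
  have "((\<lambda>v. \<bar>det (matrix (g' v))\<bar>) has_integral measure lebesgue (g ` V)) V"
    using has_measure_differentiable_image[of V g g' "measure lebesgue (g ` V)"] V der inj' lm
    by (auto intro: sets_completionI_sets)
  then have "(\<integral>\<^sup>+v\<in>V. ennreal ((cmod (f' (vec_to_complex v)))\<^sup>2) \<partial>lborel) = ennreal (measure lebesgue (g ` V))"
    unfolding det by (intro nn_integral_has_integral_lebesgue') auto
  also have "\<dots> = emeasure lborel (f ` S)"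
    using lm eqs by (simp add: emeasure_eq_measure2)
  finally have "emeasure lborel (f ` S) = (\<integral>\<^sup>+v\<in>V. ennreal ((cmod (f' (vec_to_complex v)))\<^sup>2) \<partial>lborel)" ..
  also have "\<dots> = (\<integral>\<^sup>+z\<in>S. ennreal ((cmod (f' z))\<^sup>2) \<partial>(distr lborel borel vec_to_complex))"
    by (subst nn_integral_distr) (auto simp: V_def indicator_def)
  finally show ?thesis unfolding distr_lborel_vec_to_complex .
qed

text \<open>
  The formula for the measure of the images of all Borel subsets of \<open>S\<close> says that two measures
  agree, which gives it for all integrands at once.
\<close>

lemma nn_integral_holomorphic_image:
  fixes f f' :: "complex \<Rightarrow> complex" and h :: "complex \<Rightarrow> ennreal"
  assumes [measurable]: "S \<in> sets borel" "f \<in> borel_measurable borel" "f' \<in> borel_measurable borel"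
      "h \<in> borel_measurable borel"
    and img: "\<And>T. T \<in> sets borel \<Longrightarrow> T \<subseteq> S \<Longrightarrow> f ` T \<in> sets borel"
    and deriv: "\<And>z. z \<in> S \<Longrightarrow> (f has_field_derivative f' z) (at z)"
    and inj: "inj_on f S" and bnd: "bounded (f ` S)"
  shows "(\<integral>\<^sup>+w\<in>f ` S. h w \<partial>lborel) = (\<integral>\<^sup>+z\<in>S. (h (f z) * ennreal ((cmod (f' z))\<^sup>2)) \<partial>lborel)"
proof -
  have fS [measurable]: "f ` S \<in> sets borel" by (rule img) auto
  let ?d = "\<lambda>z. ennreal ((cmod (f' z))\<^sup>2) * indicator S z"
  have "density lborel (indicator (f ` S)) = distr (density lborel ?d) borel f"
  proof (rule measure_eqI)
    fix A assume "A \<in> sets (density lborel (indicator (f ` S)))"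
    then have A [measurable]: "A \<in> sets borel" by simp
    let ?T = "S \<inter> f -` A"
    have T [measurable]: "?T \<in> sets borel"
      using measurable_sets[OF assms(2) A] by auto
    have eq: "f ` ?T = f ` S \<inter> A" by auto
    have "emeasure (density lborel (indicator (f ` S))) A = emeasure lborel (f ` ?T)"
      unfolding eq by (simp add: emeasure_density flip: indicator_inter_arith)
    also have "\<dots> = (\<integral>\<^sup>+z\<in>?T. ennreal ((cmod (f' z))\<^sup>2) \<partial>lborel)"
      using inj bnd by (intro emeasure_holomorphic_image img deriv)
        (auto intro: inj_on_subset bounded_subset)
    also have "\<dots> = emeasure (distr (density lborel ?d) borel f) A"
    proof -
      have [measurable]: "f -` A \<in> sets borel" using measurable_sets[OF assms(2) A] by simp
      show ?thesis
        by (simp add: emeasure_distr emeasure_density indicator_inter_arith mult.assoc indicator_vimage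
            cong: nn_integral_cong_simp) 
    qed
    finally show "emeasure (density lborel (indicator (f ` S))) A = emeasure (distr (density lborel ?d) borel f) A" .
  qed simp
  then have "(\<integral>\<^sup>+w. h w \<partial>density lborel (indicator (f ` S))) = (\<integral>\<^sup>+w. h w \<partial>distr (density lborel ?d) borel f)"
    by simp
  then show ?thesis
    by (simp add: nn_integral_density nn_integral_distr mult_ac)
qed

lemma borel_image_injective_holomorphic:
  assumes "f holomorphic_on U" "open U" "inj_on f U" "T \<subseteq> U" and [measurable]: "T \<in> sets borel"
  shows "f ` T \<in> sets borel"
proof -
  obtain g where g: "g holomorphic_on f ` U" "\<And>z. z \<in> U \<Longrightarrow> g (f z) = z"
    using holomorphic_has_inverse[OF assms(1-3)] by metis
  have op: "open (f ` U)" by (rule open_mapping_thm3[OF assms(1-3)])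
  have "g \<in> borel_measurable (restrict_space borel (f ` U))"
    using g(1) by (intro borel_measurable_continuous_on_restrict holomorphic_on_imp_continuous_on)
  from measurable_sets[OF this assms(5)]
  have "g -` T \<inter> f ` U \<in> sets borel"
    using op by (simp add: space_restrict_space sets_restrict_space_iff)
  moreover have "g -` T \<inter> f ` U = f ` T" using g(2) assms(4) by auto
  ultimately show ?thesis by simp
qed

text \<open>
  The map is locally injective at noncritical points, so the set of these splits into countably
  many Borel pieces on each of which the map is injective; the number of preimages of \<open>w\<close> is the
  number of pieces whose image contains \<open>w\<close>. Critical points contribute nothing to the
  right-hand side since the integrand vanishes there.
\<close>

theorem area_formula_holomorphic:
  fixes f f' :: "complex \<Rightarrow> complex" and h :: "complex \<Rightarrow> ennreal"
  assumes U: "open U"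
    and [measurable]: "f \<in> borel_measurable borel" "f' \<in> borel_measurable borel" "h \<in> borel_measurable borel"
    and deriv: "\<And>z. z \<in> U \<Longrightarrow> (f has_field_derivative f' z) (at z)"
  shows "(\<lambda>w. emeasure (count_space UNIV) {z \<in> U. f' z \<noteq> 0 \<and> f z = w}) \<in> borel_measurable borel"
    and "(\<integral>\<^sup>+w. h w * emeasure (count_space UNIV) {z \<in> U. f' z \<noteq> 0 \<and> f z = w} \<partial>lborel)
       = (\<integral>\<^sup>+z\<in>U. (h (f z) * ennreal ((cmod (f' z))\<^sup>2)) \<partial>lborel)"
proof -
  have holo: "f holomorphic_on U"
    using deriv by (auto simp: holomorphic_on_open[OF U])
  have f'_eq: "deriv f z = f' z" if "z \<in> U" for z using deriv[OF that] by (rule DERIV_imp_deriv)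
  define V where "V = {z \<in> U. f' z \<noteq> 0}"
  have "continuous_on U f'"
    using holomorphic_on_imp_continuous_on[OF holomorphic_deriv[OF holo U]]
    by (rule continuous_on_eq) (simp add: f'_eq)
  then have V: "open V"
    using continuous_open_preimage[OF _ U open_Compl[OF closed_singleton[of 0]], of f']
    by (simp add: V_def vimage_def Collect_conj_eq)
  have VU: "V \<subseteq> U" by (auto simp: V_def)
  have holoV: "f holomorphic_on V" using holo VU by (rule holomorphic_on_subset)
  define good where "good = {D. open D \<and> D \<subseteq> V \<and> inj_on f D \<and> bounded (f ` D)}"
  have "\<exists>D\<in>good. z \<in> D" if z: "z \<in> V" for z
  proof -
    have "deriv f z \<noteq> 0" using z f'_eq by (auto simp: V_def)
    then obtain r where r: "r > 0" "ball z r \<subseteq> V" "inj_on f (ball z r)"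
      using has_complex_derivative_locally_injective[OF holoV z V] by metis
    \<comment> \<open>Halving the radius makes the image bounded, being contained in a compact set.\<close>
    have sub: "cball z (r/2) \<subseteq> ball z r" using r by auto
    have "compact (f ` cball z (r/2))"
      using sub r by (intro compact_continuous_image holomorphic_on_imp_continuous_on
          holomorphic_on_subset[OF holoV]) auto
    then have "bounded (f ` ball z (r/2))"
      by (intro bounded_subset[OF compact_imp_bounded image_mono[OF ball_subset_cball]])
    moreover have "ball z (r/2) \<subseteq> ball z r" using r by auto
    ultimately have "ball z (r/2) \<in> good"
      using r by (auto simp: good_def intro: inj_on_subset)
    then show ?thesis using r by (intro bexI[of _ "ball z (r/2)"]) auto
  qed
  then have cover: "\<Union>good = V" by (auto simp: good_def)
  obtain \<F> where \<F>: "\<F> \<subseteq> good" "countable \<F>" "\<Union>\<F> = \<Union>good"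
    using Lindelof[of good] by (auto simp: good_def)
  \<comment> \<open>The empty set makes the family nonempty, so that a sequence can enumerate it.\<close>
  define \<G> where "\<G> = insert {} \<F>"
  have \<G>: "\<G> \<subseteq> good" "countable \<G>" "\<Union>\<G> = V" "\<G> \<noteq> {}"
    using \<F> cover by (auto simp: \<G>_def good_def)
  define D where "D = from_nat_into \<G>"
  have D: "D i \<in> good" for i unfolding D_def using from_nat_into[OF \<G>(4)] \<G>(1) by blast
  have UD: "(\<Union>i. D i) = V" unfolding D_def using \<G> by (simp add: range_from_nat_into)
  define B where "B = disjointed D"
  have disj: "disjoint_family B" unfolding B_def by (rule disjoint_family_disjointed)
  have UB: "(\<Union>i. B i) = V" unfolding B_def using UD by (simp add: UN_disjointed_eq)
  have BD: "B i \<subseteq> D i" for i unfolding B_def by (rule disjointed_subset)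
  have B [measurable]: "B i \<in> sets borel" for i
  proof -
    have "range D \<subseteq> sets borel" using D by (auto simp: good_def)
    then show ?thesis unfolding B_def using sets.range_disjointed_sets[of D borel] by blast
  qed
  have injB: "inj_on f (B i)" for i using D[of i] BD[of i] by (auto simp: good_def intro: inj_on_subset)
  have img: "f ` T \<in> sets borel" if "T \<in> sets borel" "T \<subseteq> B i" for T i
    using D[of i] BD[of i] that holoV
    by (intro borel_image_injective_holomorphic[of f "D i"]) (auto simp: good_def intro: holomorphic_on_subset)
  have imgB [measurable]: "f ` B i \<in> sets borel" for i by (rule img) auto
  have count: "emeasure (count_space UNIV) {z \<in> U. f' z \<noteq> 0 \<and> f z = w} = (\<Sum>i. indicator (f ` B i) w)" for w
  proof -
    have "{z \<in> U. f' z \<noteq> 0 \<and> f z = w} = (\<Union>i. {z \<in> B i. f z = w})"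
      using UB by (auto simp: V_def)
    moreover have "(\<Sum>i. emeasure (count_space UNIV) {z \<in> B i. f z = w})
        = emeasure (count_space UNIV) (\<Union>i. {z \<in> B i. f z = w})"
      using disj by (intro suminf_emeasure) (auto simp: disjoint_family_on_def)
    moreover have "emeasure (count_space UNIV) {z \<in> B i. f z = w} = (indicator (f ` B i) w :: ennreal)" for i
    proof (cases "w \<in> f ` B i")
      case True
      then obtain z where "z \<in> B i" "f z = w" by auto
      then have "{z \<in> B i. f z = w} = {z}" using injB[of i] by (auto simp: inj_on_def)
      then show ?thesis using True by simp
    next
      case False
      then have "{z \<in> B i. f z = w} = {}" by auto
      then show ?thesis using False by (simp del: Collect_empty_eq)
    qed
    ultimately show ?thesis by simp
  qed
  show "(\<lambda>w. emeasure (count_space UNIV) {z \<in> U. f' z \<noteq> 0 \<and> f z = w}) \<in> borel_measurable borel"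
    unfolding count by measurable
  have "(\<integral>\<^sup>+w. h w * emeasure (count_space UNIV) {z \<in> U. f' z \<noteq> 0 \<and> f z = w} \<partial>lborel)
      = (\<Sum>i. \<integral>\<^sup>+w\<in>f ` B i. h w \<partial>lborel)"
    unfolding count ennreal_suminf_cmult[symmetric] by (intro nn_integral_suminf) measurable
  also have "\<dots> = (\<Sum>i. \<integral>\<^sup>+z\<in>B i. (h (f z) * ennreal ((cmod (f' z))\<^sup>2)) \<partial>lborel)"
  proof (intro suminf_cong nn_integral_holomorphic_image)
    fix i show "bounded (f ` B i)"
      using D[of i] BD[of i] by (auto simp: good_def intro: bounded_subset[OF _ image_mono])
    show "(f has_field_derivative f' z) (at z)" if "z \<in> B i" for z
      using that UB VU deriv by blast
  qed (use injB img in auto)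
  also have "\<dots> = (\<integral>\<^sup>+z. (\<Sum>i. (h (f z) * ennreal ((cmod (f' z))\<^sup>2)) * indicator (B i) z) \<partial>lborel)"
    by (intro nn_integral_suminf[symmetric]) measurable
  also have "\<dots> = (\<integral>\<^sup>+z\<in>V. (h (f z) * ennreal ((cmod (f' z))\<^sup>2)) \<partial>lborel)"
    unfolding ennreal_suminf_cmult suminf_indicator[OF disj] UB ..
  also have "\<dots> = (\<integral>\<^sup>+z\<in>U. (h (f z) * ennreal ((cmod (f' z))\<^sup>2)) \<partial>lborel)"
    by (intro nn_integral_cong) (auto simp: V_def indicator_def)
  finally show "(\<integral>\<^sup>+w. h w * emeasure (count_space UNIV) {z \<in> U. f' z \<noteq> 0 \<and> f z = w} \<partial>lborel)
       = (\<integral>\<^sup>+z\<in>U. (h (f z) * ennreal ((cmod (f' z))\<^sup>2)) \<partial>lborel)" .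
qed

section \<open>Measurability of the number of zeros\<close>

lemma finite_zeros_entire:
  assumes "p holomorphic_on UNIV" "p w \<noteq> 0" "bounded S"
  shows "finite {z \<in> S. p z = 0}"
proof (cases "p constant_on UNIV")
  case True
  then have "p z \<noteq> 0" for z using assms(2) by (auto simp: constant_on_def)
  then show ?thesis by simp
next
  case False
  have "finite {z \<in> closure S. p z = 0}"
    using assms(3) False by (intro holomorphic_compact_finite_zeros[OF assms(1)]) auto
  then show ?thesis by (rule rev_finite_subset) (use closure_subset in auto)
qed

lemma zorder_pos_entire:
  assumes "p holomorphic_on UNIV" "p w \<noteq> 0" "p z = 0"
  shows "zorder p z > 0"
  using zorder_exist_zero[OF assms(1) open_UNIV connected_UNIV, of z] assms(2,3) by auto

text \<open>
  Rouche's theorem counts zeros weighted by winding numbers; for a circle these are 1 inside and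
  0 outside.
\<close>

lemma Rouche_disc:
  assumes hol: "p holomorphic_on UNIV" "q holomorphic_on UNIV"
    and nz: "p w \<noteq> 0" "q v \<noteq> 0"
    and r: "r > 0" and less: "\<And>z. z \<in> sphere a r \<Longrightarrow> cmod (q z - p z) < cmod (p z)"
  shows "(\<Sum>z\<in>{z \<in> ball a r. q z = 0}. zorder q z) = (\<Sum>z\<in>{z \<in> ball a r. p z = 0}. zorder p z)"
proof -
  \<comment> \<open>The domain is bounded, so that only finitely many zeros occur in it, and contains the closed disc.\<close>
  let ?s = "ball a (2 * r)" and ?g = "circlepath a r"
  have fin: "finite {z \<in> ?s. p z = 0}" "finite {z \<in> ?s. q z = 0}"
    using finite_zeros_entire hol nz bounded_ball by blast+
  have sub: "sphere a r \<subseteq> ?s" using r by auto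
  have path: "path_image ?g = sphere a r" using r by simp
  have "(\<Sum>z\<in>{z \<in> ?s. p z + (q z - p z) = 0}. winding_number ?g z * zorder (\<lambda>z. p z + (q z - p z)) z)
      = (\<Sum>z\<in>{z \<in> ?s. p z = 0}. winding_number ?g z * zorder p z)"
  proof (rule Rouche_theorem)
    show "\<forall>z. z \<notin> ?s \<longrightarrow> winding_number ?g z = 0"
      using sub path by (intro allI impI winding_number_zero_outside[where s = "?s"]) auto
    show "\<forall>z\<in>path_image ?g. cmod (q z - p z) < cmod (p z)" using less path by auto
    show "(\<lambda>z. q z - p z) holomorphic_on ?s"
      using hol by (intro holomorphic_intros) (auto intro: holomorphic_on_subset)
    show "p holomorphic_on ?s" using hol by (auto intro: holomorphic_on_subset)
  qed (use fin sub path in auto)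
  then have eq: "(\<Sum>z\<in>{z \<in> ?s. q z = 0}. winding_number ?g z * zorder q z)
      = (\<Sum>z\<in>{z \<in> ?s. p z = 0}. winding_number ?g z * zorder p z)" by simp
  have wn: "(\<Sum>z\<in>{z \<in> ?s. h z = 0}. winding_number ?g z * zorder h z)
      = of_int (\<Sum>z\<in>{z \<in> ball a r. h z = 0}. zorder h z)"
    if "finite {z \<in> ?s. h z = 0}" "\<And>z. z \<in> sphere a r \<Longrightarrow> h z \<noteq> 0" for h :: "complex \<Rightarrow> complex"
  proof -
    have "(\<Sum>z\<in>{z \<in> ?s. h z = 0}. winding_number ?g z * zorder h z)
      = (\<Sum>z\<in>{z \<in> ball a r. h z = 0}. winding_number ?g z * zorder h z)"
    proof (rule sum.mono_neutral_right[OF that(1)])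
      show "\<forall>z\<in>{z \<in> ?s. h z = 0} - {z \<in> ball a r. h z = 0}. winding_number ?g z * zorder h z = 0"
      proof
        fix z assume z: "z \<in> {z \<in> ?s. h z = 0} - {z \<in> ball a r. h z = 0}"
        then have "z \<notin> cball a r" using that(2)[of z] by (auto simp: dist_commute)
        then have "winding_number ?g z = 0"
          using r path by (intro winding_number_zero_outside[where s = "cball a r"]) auto
        then show "winding_number ?g z * zorder h z = 0" by simp
      qed
    qed (use r in auto)
    also have "\<dots> = (\<Sum>z\<in>{z \<in> ball a r. h z = 0}. of_int (zorder h z))"
      by (intro sum.cong refl) (auto simp: winding_number_circlepath dist_norm norm_minus_commute)
    finally show ?thesis by simp
  qed
  have nonzero: "p z \<noteq> 0" "q z \<noteq> 0" if "z \<in> sphere a r" for z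
    using less[OF that] by auto
  have "complex_of_int (\<Sum>z\<in>{z \<in> ball a r. q z = 0}. zorder q z)
      = of_int (\<Sum>z\<in>{z \<in> ball a r. p z = 0}. zorder p z)"
    
  proof -
    have "(\<Sum>z\<in>{z \<in> ?s. q z = 0}. winding_number ?g z * zorder q z)
        = of_int (\<Sum>z\<in>{z \<in> ball a r. q z = 0}. zorder q z)"
      by (rule wn[OF fin(2)]) (rule nonzero)
    moreover have "(\<Sum>z\<in>{z \<in> ?s. p z = 0}. winding_number ?g z * zorder p z)
        = of_int (\<Sum>z\<in>{z \<in> ball a r. p z = 0}. zorder p z)"
      by (rule wn[OF fin(1)]) (rule nonzero)
    ultimately show ?thesis using eq by (simp only:)
  qed
  then show ?thesis by (simp only: of_int_eq_iff)
qed

text \<open>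
  Each zero in the open set is surrounded by a small circle, the discs being disjoint and inside
  the set. A function close enough to \<open>p\<close> on the circles has the same number of zeros as \<open>p\<close> in
  each disc, hence at least as many zeros in all.
\<close>

lemma zero_count_lower_semicontinuous:
  assumes hol: "p holomorphic_on UNIV" and nz: "p w \<noteq> 0" and \<Omega>: "open \<Omega>" "bounded \<Omega>"
  shows "\<exists>C \<delta>. compact C \<and> 0 < \<delta> \<and> (\<forall>q v. q holomorphic_on UNIV \<longrightarrow> q v \<noteq> 0 \<longrightarrow>
    (\<forall>z\<in>C. cmod (q z - p z) < \<delta>) \<longrightarrow> zero_count p \<Omega> \<le> zero_count q \<Omega>)"
proof -
  define Z where "Z = {z \<in> \<Omega>. p z = 0}"
  have finZ: "finite Z" unfolding Z_def by (rule finite_zeros_entire[OF hol nz \<Omega>(2)])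
  have "\<exists>e>0. cball a e \<subseteq> \<Omega> \<and> (\<forall>b\<in>Z. b \<noteq> a \<longrightarrow> e \<le> dist a b)" if aZ: "a \<in> Z" for a
  proof -
    have "a \<in> \<Omega>" using aZ by (simp add: Z_def)
    then obtain e where e: "e > 0" "cball a e \<subseteq> \<Omega>"
      using open_contains_cball[THEN iffD1, OF \<Omega>(1)] by blast
    obtain d where d: "d > 0" "\<forall>b\<in>Z. b \<noteq> a \<longrightarrow> d \<le> dist a b"
      using finite_set_avoid[OF finZ, of a] by blast
    have "cball a (min d e) \<subseteq> cball a e" by auto
    then have "cball a (min d e) \<subseteq> \<Omega>" using e(2) by blast
    then show ?thesis using e(1) d by (intro exI[of _ "min d e"]) auto
  qed
  then obtain e where "\<forall>a\<in>Z. e a > 0 \<and> cball a (e a) \<subseteq> \<Omega> \<and> (\<forall>b\<in>Z. b \<noteq> a \<longrightarrow> e a \<le> dist a b)"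
    using bchoice[of Z "\<lambda>a e. e > 0 \<and> cball a e \<subseteq> \<Omega> \<and> (\<forall>b\<in>Z. b \<noteq> a \<longrightarrow> e \<le> dist a b)"] by blast
  then have e: "\<And>a. a \<in> Z \<Longrightarrow> e a > 0" "\<And>a. a \<in> Z \<Longrightarrow> cball a (e a) \<subseteq> \<Omega>"
      "\<And>a b. a \<in> Z \<Longrightarrow> b \<in> Z \<Longrightarrow> b \<noteq> a \<Longrightarrow> e a \<le> dist a b"
    by auto
  \<comment> \<open>A third of the least admissible radius keeps the closed discs pairwise disjoint.\<close>
  define r where "r = (if Z = {} then 1 else Min (e ` Z) / 3)"
  have r: "r > 0" unfolding r_def using e(1) finZ by auto
  have re: "3 * r \<le> e a" if "a \<in> Z" for a
    using that finZ by (auto simp: r_def)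
  have sub: "cball a r \<subseteq> \<Omega>" if "a \<in> Z" for a
    using e(2)[OF that] re[OF that] r by auto
  have only: "z = a" if "a \<in> Z" "z \<in> cball a r" "p z = 0" for a z
  proof (rule ccontr)
    assume "z \<noteq> a"
    moreover have "z \<in> \<Omega>" using sub[OF that(1)] that(2) by blast
    then have "z \<in> Z" using that(3) by (simp add: Z_def)
    ultimately have "e a \<le> dist a z" using e(3) that(1) by blast
    then show False using that(2) re[OF that(1)] r by simp
  qed
  have disj: "cball a r \<inter> cball b r = {}" if "a \<in> Z" "b \<in> Z" "a \<noteq> b" for a b
  proof (rule ccontr)
    assume "cball a r \<inter> cball b r \<noteq> {}"
    then obtain x where "dist a x \<le> r" "dist b x \<le> r" by auto
    then have "dist a b \<le> 2 * r" using dist_triangle3[of a b x] by (simp add: dist_commute)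
    then show False using e(3)[OF that(1,2)] that(3) re[OF that(1)] r by simp
  qed
  define C where "C = (\<Union>a\<in>Z. sphere a r)"
  have C: "compact C" unfolding C_def using finZ by (intro compact_UN) auto
  have pC: "p z \<noteq> 0" if zC: "z \<in> C" for z
  proof
    assume "p z = 0"
    obtain a where a: "a \<in> Z" "dist a z = r" using zC unfolding C_def sphere_def by blast
    then have "z = a" using only[of a z] \<open>p z = 0\<close> by auto
    then show False using a r by simp
  qed
  have "\<exists>\<delta>>0. \<forall>z\<in>C. \<delta> \<le> cmod (p z)"
  proof (cases "C = {}")
    case False
    have "continuous_on C (\<lambda>z. cmod (p z))"
      using hol by (intro continuous_intros holomorphic_on_imp_continuous_on) (auto intro: holomorphic_on_subset)
    from continuous_attains_inf[OF C False this] obtain x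
      where "x \<in> C" "\<forall>z\<in>C. cmod (p x) \<le> cmod (p z)" by blast
    then show ?thesis using pC by (intro exI[of _ "cmod (p x)"]) auto
  qed (auto intro: exI[of _ 1])
  then obtain \<delta> where \<delta>: "\<delta> > 0" "\<And>z. z \<in> C \<Longrightarrow> \<delta> \<le> cmod (p z)" by auto
  show ?thesis
  proof (intro exI conjI allI impI)
    fix q v assume q: "q holomorphic_on UNIV" "q v \<noteq> 0" and close: "\<forall>z\<in>C. cmod (q z - p z) < \<delta>"
    have finq: "finite {z \<in> \<Omega>. q z = 0}" by (rule finite_zeros_entire[OF q \<Omega>(2)])
    let ?Q = "\<lambda>a. {z \<in> ball a r. q z = 0}"
    have local: "nat (zorder p a) = (\<Sum>z\<in>?Q a. nat (zorder q z))" if a: "a \<in> Z" for a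
    proof -
      have "(\<Sum>z\<in>?Q a. zorder q z) = (\<Sum>z\<in>{z \<in> ball a r. p z = 0}. zorder p z)"
      proof (rule Rouche_disc[OF hol q(1) nz q(2) r])
        fix z assume "z \<in> sphere a r"
        then have "z \<in> C" using a by (auto simp: C_def)
        then show "cmod (q z - p z) < cmod (p z)" using close \<delta>(2) by (meson less_le_trans)
      qed
      moreover have "{z \<in> ball a r. p z = 0} = {a}"
        using only[OF a] r a by (auto simp: Z_def)
      moreover have "zorder q z = int (nat (zorder q z))" if "z \<in> ?Q a" for z
        using zorder_pos_entire[OF q, of z] that by simp
      ultimately have "zorder p a = (\<Sum>z\<in>?Q a. int (nat (zorder q z)))" by simp
      then show ?thesis by (simp only: of_nat_sum[symmetric] nat_int)
    qed
    have "(\<Sum>a\<in>Z. nat (zorder p a)) = (\<Sum>a\<in>Z. \<Sum>z\<in>?Q a. nat (zorder q z))"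
      using local by (intro sum.cong) auto
    also have "\<dots> = (\<Sum>z\<in>(\<Union>a\<in>Z. ?Q a). nat (zorder q z))"
    proof (rule sum.UNION_disjoint[symmetric, OF finZ])
      show "\<forall>a\<in>Z. finite (?Q a)" using finite_zeros_entire[OF q bounded_ball] by blast
      show "\<forall>a\<in>Z. \<forall>b\<in>Z. a \<noteq> b \<longrightarrow> ?Q a \<inter> ?Q b = {}"
      proof (intro ballI impI)
        fix a b assume "a \<in> Z" "b \<in> Z" "a \<noteq> b"
        from disj[OF this] show "?Q a \<inter> ?Q b = {}" using ball_subset_cball by blast
      qed
    qed
    also have "\<dots> \<le> (\<Sum>z\<in>{z \<in> \<Omega>. q z = 0}. nat (zorder q z))"
    proof (intro sum_mono2 finq)
      show "(\<Union>a\<in>Z. ?Q a) \<subseteq> {z \<in> \<Omega>. q z = 0}" using sub ball_subset_cball by blast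
    qed simp
    finally show "zero_count p \<Omega> \<le> zero_count q \<Omega>"
      using finq finZ unfolding zero_count_def Z_def[symmetric] by (simp del: of_nat_sum)
  qed (use C \<delta>(1) in auto)
qed

definition lin_comb :: "(nat \<Rightarrow> complex \<Rightarrow> complex) \<Rightarrow> nat \<Rightarrow> (nat \<Rightarrow> complex) \<Rightarrow> complex \<Rightarrow> complex" where
  "lin_comb f n c z = (\<Sum>j\<le>n. c j * f j z)"

lemma holomorphic_lin_comb:
  assumes "\<And>j. j \<le> n \<Longrightarrow> f j holomorphic_on A"
  shows "lin_comb f n c holomorphic_on A"
  unfolding lin_comb_def by (intro holomorphic_intros assms) auto

text \<open>
  On the closed set of coefficients for which the combination is the zero function the count is
  constant; on its complement the count is lower semicontinuous. Coefficients outside \<open>{..n}\<close> do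
  not enter, which allows the use of the product topology on all sequences.
\<close>

lemma borel_measurable_zero_count:
  assumes hol: "\<And>j. j \<le> n \<Longrightarrow> f j holomorphic_on UNIV" and \<Omega>: "open \<Omega>" "bounded \<Omega>"
  shows "(\<lambda>c. zero_count (lin_comb f n c) \<Omega>) \<in> borel_measurable borel"
proof -
  define N where "N c = zero_count (lin_comb f n c) \<Omega>" for c
  define Z where "Z = {c. \<forall>z. lin_comb f n c z = 0}"
  have cont: "continuous_on UNIV (\<lambda>c. lin_comb f n c z)" for z
    unfolding lin_comb_def by (intro continuous_intros continuous_on_product_coordinates)
  have "closed {c. lin_comb f n c z = 0}" for z
    using cont by (intro closed_Collect_eq) auto
  then have Z: "closed Z" unfolding Z_def by (rule closed_Collect_all)
  have NZ: "N c = zero_count (\<lambda>_. 0) \<Omega>" if "c \<in> Z" for c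
    using that by (auto simp: Z_def N_def fun_eq_iff intro!: arg_cong[of _ _ "\<lambda>p. zero_count p \<Omega>"])
  have lsc: "\<exists>W. open W \<and> c0 \<in> W \<and> (\<forall>c\<in>W - Z. N c0 \<le> N c)" if c0: "c0 \<notin> Z" for c0
  proof -
    obtain w where w: "lin_comb f n c0 w \<noteq> 0" using c0 by (auto simp: Z_def)
    obtain C \<delta> where C: "compact C" "\<delta> > 0"
      "\<forall>q v. q holomorphic_on UNIV \<longrightarrow> q v \<noteq> 0 \<longrightarrow> (\<forall>z\<in>C. cmod (q z - lin_comb f n c0 z) < \<delta>)
       \<longrightarrow> zero_count (lin_comb f n c0) \<Omega> \<le> zero_count q \<Omega>"
      using zero_count_lower_semicontinuous[OF holomorphic_lin_comb[OF hol] w \<Omega>] by blast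
    have "\<exists>M. \<forall>z\<in>C. cmod (f j z) \<le> M" if "j \<le> n" for j
      using compact_imp_bounded[OF compact_continuous_image[OF _ C(1)], of "f j"] hol[OF that]
      by (auto simp: bounded_iff intro: holomorphic_on_imp_continuous_on holomorphic_on_subset)
    then obtain M where M: "\<And>j z. j \<le> n \<Longrightarrow> z \<in> C \<Longrightarrow> cmod (f j z) \<le> M j" by metis
    define W where "W = {c. (\<Sum>j\<le>n. cmod (c j - c0 j) * M j) < \<delta>}"
    have "open W" unfolding W_def
      by (intro open_Collect_less continuous_intros continuous_on_product_coordinates)
    moreover have "c0 \<in> W" using C(2) by (simp add: W_def)
    moreover have "N c0 \<le> N c" if c: "c \<in> W - Z" for c
    proof -
      obtain v where v: "lin_comb f n c v \<noteq> 0" using c by (auto simp: Z_def)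
      show ?thesis unfolding N_def
      proof (rule C(3)[rule_format, OF holomorphic_lin_comb[OF hol] v])
        fix z assume z: "z \<in> C"
        have "lin_comb f n c z - lin_comb f n c0 z = (\<Sum>j\<le>n. (c j - c0 j) * f j z)"
          by (simp add: lin_comb_def sum_subtractf left_diff_distrib)
        also have "cmod \<dots> \<le> (\<Sum>j\<le>n. cmod (c j - c0 j) * M j)"
          using M z by (intro sum_norm_le) (auto simp: norm_mult intro!: mult_left_mono)
        also have "\<dots> < \<delta>" using c by (simp add: W_def)
        finally show "cmod (lin_comb f n c z - lin_comb f n c0 z) < \<delta>" .
      qed
    qed
    ultimately show ?thesis by blast
  qed
  have "N \<in> borel_measurable borel"
  proof (rule borel_measurableI_greater)
    fix y
    have "open {c. c \<notin> Z \<and> y < N c}"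
    proof (subst open_subopen, intro ballI)
      fix c0 assume "c0 \<in> {c. c \<notin> Z \<and> y < N c}"
      then have c0: "c0 \<notin> Z" "y < N c0" by auto
      obtain W where W: "open W" "c0 \<in> W" "\<forall>c\<in>W - Z. N c0 \<le> N c" using lsc[OF c0(1)] by blast
      have "W - Z \<subseteq> {c. c \<notin> Z \<and> y < N c}" using W(3) c0(2) by (auto intro: less_le_trans)
      then show "\<exists>T. open T \<and> c0 \<in> T \<and> T \<subseteq> {c. c \<notin> Z \<and> y < N c}"
        using W Z c0 by (intro exI[of _ "W - Z"]) auto
    qed
    moreover have "{c \<in> space borel. y < N c} = {c. c \<notin> Z \<and> y < N c} \<union> (if y < zero_count (\<lambda>_. 0) \<Omega> then Z else {})"
      using NZ by auto
    moreover have "Z \<in> sets borel" using Z by simp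
    ultimately show "{c \<in> space borel. y < N c} \<in> sets borel" by auto
  qed
  then show ?thesis by (simp add: N_def[abs_def])
qed

section \<open>The density and common zeros\<close>

text \<open>
  The Gram determinant of the vectors \<open>a\<close> and \<open>b\<close> for the standard Hermitian inner product.
\<close>

definition gram :: "'i set \<Rightarrow> ('i \<Rightarrow> complex) \<Rightarrow> ('i \<Rightarrow> complex) \<Rightarrow> real" where
  "gram I a b = (\<Sum>j\<in>I. (cmod (b j))\<^sup>2) * (\<Sum>j\<in>I. (cmod (a j))\<^sup>2) - (cmod (\<Sum>j\<in>I. a j * cnj (b j)))\<^sup>2"

lemma gram_nonneg: "0 \<le> gram I a b"
proof -
  have "cmod (\<Sum>j\<in>I. a j * cnj (b j)) \<le> (\<Sum>j\<in>I. cmod (a j) * cmod (b j))"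
    by (rule order_trans[OF norm_sum]) (simp add: norm_mult)
  then have "(cmod (\<Sum>j\<in>I. a j * cnj (b j)))\<^sup>2 \<le> (\<Sum>j\<in>I. cmod (a j) * cmod (b j))\<^sup>2"
    by (intro power_mono) auto
  also have "\<dots> \<le> (\<Sum>j\<in>I. (cmod (a j))\<^sup>2) * (\<Sum>j\<in>I. (cmod (b j))\<^sup>2)"
    by (rule Cauchy_Schwarz_ineq_sum)
  finally show ?thesis by (simp add: gram_def mult.commute)
qed

text \<open>
  The Gram determinant is unchanged when a multiple of one vector is added to the other, and
  homogeneous of degree two in the squared norm of a common factor.
\<close>

lemma gram_scale:
  "gram I (\<lambda>j. q * a j) (\<lambda>j. p * a j + q * b j) = (cmod q)^4 * gram I a b"
proof -
  define A B X where "A = (\<Sum>j\<in>I. a j * cnj (a j))" "B = (\<Sum>j\<in>I. b j * cnj (b j))"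
    "X = (\<Sum>j\<in>I. a j * cnj (b j))"
  have cX: "cnj X = (\<Sum>j\<in>I. b j * cnj (a j))" by (simp add: A_B_X_def mult.commute)
  have "complex_of_real (gram I (\<lambda>j. q * a j) (\<lambda>j. p * a j + q * b j))
      = (\<Sum>j\<in>I. (p * a j + q * b j) * cnj (p * a j + q * b j)) * (\<Sum>j\<in>I. q * a j * cnj (q * a j))
        - (\<Sum>j\<in>I. q * a j * cnj (p * a j + q * b j)) * cnj (\<Sum>j\<in>I. q * a j * cnj (p * a j + q * b j))"
    unfolding gram_def of_real_diff of_real_mult of_real_sum complex_norm_square ..
  also have "(\<Sum>j\<in>I. (p * a j + q * b j) * cnj (p * a j + q * b j))
      = p * cnj p * A + p * cnj q * X + q * cnj p * cnj X + q * cnj q * B"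
    unfolding cX unfolding A_B_X_def by (simp add: sum_distrib_left sum.distrib algebra_simps)
  also have "(\<Sum>j\<in>I. q * a j * cnj (q * a j)) = q * cnj q * A"
    unfolding A_B_X_def by (simp add: sum_distrib_left algebra_simps)
  also have "(\<Sum>j\<in>I. q * a j * cnj (p * a j + q * b j)) = q * cnj p * A + q * cnj q * X"
    unfolding A_B_X_def by (simp add: sum_distrib_left sum.distrib algebra_simps)
  also have "(p * cnj p * A + p * cnj q * X + q * cnj p * cnj X + q * cnj q * B) * (q * cnj q * A)
      - (q * cnj p * A + q * cnj q * X) * cnj (q * cnj p * A + q * cnj q * X)
      = (q * cnj q)\<^sup>2 * (B * A - X * cnj X)"
  proof -
    have "cnj A = A" by (simp add: A_B_X_def mult.commute)
    then show ?thesis by (simp add: power2_eq_square algebra_simps)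
  qed
  also have "\<dots> = complex_of_real (((cmod q)\<^sup>2)\<^sup>2 * gram I a b)"
    unfolding gram_def of_real_diff of_real_mult of_real_sum of_real_power[of "(cmod q)\<^sup>2" 2]
      complex_norm_square A_B_X_def ..
  finally show ?thesis by (simp only: of_real_eq_iff) (simp flip: power_mult)
qed

lemma zero_density_eq_gram:
  "zero_density f n z = gram {..n} (\<lambda>j. f j z) (\<lambda>j. deriv (f j) z) / (pi * (\<Sum>j\<le>n. (cmod (f j z))\<^sup>2)\<^sup>2)"
proof -
  have "Re (x * cnj x) = (cmod x)\<^sup>2" for x unfolding cmod_power2 by (simp add: power2_eq_square)
  then show ?thesis
    unfolding zero_density_def sum_kernel_def sum_kernel01_def sum_kernel11_def gram_def Re_sum
    by (simp only:)
qed

lemma zero_density_nonneg: "0 \<le> zero_density f n z"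
  unfolding zero_density_eq_gram by (intro divide_nonneg_nonneg gram_nonneg) simp

lemma sum_kernel_eq_0_iff: "sum_kernel f n z z = 0 \<longleftrightarrow> (\<forall>j\<le>n. f j z = 0)"
proof -
  have "sum_kernel f n z z = of_real (\<Sum>j\<le>n. (cmod (f j z))\<^sup>2)"
    unfolding sum_kernel_def of_real_sum complex_norm_square ..
  then have "sum_kernel f n z z = 0 \<longleftrightarrow> (\<Sum>j\<le>n. (cmod (f j z))\<^sup>2) = 0"
    by (simp only: of_real_eq_0_iff)
  then show ?thesis by (auto simp: sum_nonneg_eq_0_iff)
qed

text \<open>
  The product rule turns the vector of derivatives into \<open>q' * g + q * g'\<close>, so that \<open>gram_scale\<close>
  applies; the squared norm in the denominator produces the same power of \<open>|q|\<close>.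
\<close>

lemma zero_density_common_factor:
  assumes f: "\<And>j w. j \<le> n \<Longrightarrow> f j w = q w * g j w"
    and diff: "q field_differentiable at z" "\<And>j. j \<le> n \<Longrightarrow> g j field_differentiable at z"
    and q: "q z \<noteq> 0"
  shows "zero_density f n z = zero_density g n z"
proof -
  have d: "deriv (f j) z = deriv q z * g j z + q z * deriv (g j) z" if "j \<le> n" for j
  proof -
    have "f j = (\<lambda>w. q w * g j w)" using f[OF that] by auto
    then show ?thesis using deriv_mult[OF diff(1) diff(2)[OF that]] by (simp add: algebra_simps)
  qed
  have "gram {..n} (\<lambda>j. f j z) (\<lambda>j. deriv (f j) z)
      = gram {..n} (\<lambda>j. q z * g j z) (\<lambda>j. deriv q z * g j z + q z * deriv (g j) z)"
    unfolding gram_def by (simp add: f d)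
  also have "\<dots> = (cmod (q z))^4 * gram {..n} (\<lambda>j. g j z) (\<lambda>j. deriv (g j) z)"
    by (rule gram_scale)
  finally have 1: "gram {..n} (\<lambda>j. f j z) (\<lambda>j. deriv (f j) z)
      = (cmod (q z))^4 * gram {..n} (\<lambda>j. g j z) (\<lambda>j. deriv (g j) z)" .
  have "(\<Sum>j\<le>n. (cmod (f j z))\<^sup>2) = (cmod (q z))\<^sup>2 * (\<Sum>j\<le>n. (cmod (g j z))\<^sup>2)"
    by (simp add: f norm_mult power_mult_distrib sum_distrib_left)
  then have 2: "(\<Sum>j\<le>n. (cmod (f j z))\<^sup>2)\<^sup>2 = (cmod (q z))^4 * (\<Sum>j\<le>n. (cmod (g j z))\<^sup>2)\<^sup>2"
    by (simp add: power_mult_distrib flip: power_mult)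
  show ?thesis unfolding zero_density_eq_gram 1 2 using q by (simp add: mult.left_commute)
qed

lemma isCont_entire:
  assumes "g holomorphic_on UNIV"
  shows "isCont g z" "isCont (deriv g) z"
proof -
  show "isCont g z"
    using holomorphic_on_imp_continuous_on[OF assms] by (simp add: continuous_on_eq_continuous_at)
  show "isCont (deriv g) z"
    using holomorphic_on_imp_continuous_on[OF holomorphic_deriv[OF assms open_UNIV]]
    by (simp add: continuous_on_eq_continuous_at)
qed

text \<open>
  One factor \<open>z - a\<close> is divided out at a time. The order \<open>r\<close> of \<open>f k\<close> at \<open>a\<close> bounds the number
  of steps; it is described by a local factorization in a punctured neighbourhood so that the
  division preserves the assumption.
\<close>

lemma common_zero_factorization:
  fixes f :: "nat \<Rightarrow> complex \<Rightarrow> complex"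
  assumes "\<And>j. j \<le> n \<Longrightarrow> f j holomorphic_on UNIV" "k \<le> n"
    and "eventually (\<lambda>z. f k z = (z - a) ^ r * h z) (at a)" "isCont h a" "h a \<noteq> 0"
  shows "\<exists>m g. (\<forall>j\<le>n. g j holomorphic_on UNIV) \<and> (\<forall>j\<le>n. \<forall>z. f j z = (z - a) ^ m * g j z)
           \<and> (\<exists>j\<le>n. g j a \<noteq> 0)"
  using assms
proof (induction r arbitrary: f)
  case 0
  have "isCont (f k) a"
    by (rule isCont_entire[OF 0(1)[OF 0(2)]])
  then have "(f k \<longlongrightarrow> f k a) (at a)" by (simp add: isCont_def)
  moreover have "(f k \<longlongrightarrow> h a) (at a)"
    using 0(3,4) by (subst tendsto_cong[of _ h]) (auto simp: isCont_def)
  ultimately have "f k a = h a" using LIM_unique by blast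
  then show ?case using 0(1,2,5) by (intro exI[of _ 0] exI[of _ f]) auto
next
  case (Suc r)
  show ?case
  proof (cases "\<exists>j\<le>n. f j a \<noteq> 0")
    case True
    then show ?thesis using Suc.prems(1) by (intro exI[of _ 0] exI[of _ f]) auto
  next
    case False
    \<comment> \<open>The value at \<open>a\<close> removes the singularity of the quotient.\<close>
    define f1 where "f1 j z = (if z = a then deriv (f j) a else f j z / (z - a))" for j z
    have hol: "f1 j holomorphic_on UNIV" if "j \<le> n" for j
    proof -
      have "f j a = 0" using False that by simp
      then have "f1 j = (\<lambda>z. if z = a then deriv (f j) a else (f j z - f j a) / (z - a))"
        by (simp add: f1_def fun_eq_iff)
      then show ?thesis
        using pole_lemma_open[OF Suc.prems(1)[OF that] open_UNIV, of a] by (simp only:)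
    qed
    have f1: "f j z = (z - a) * f1 j z" if "j \<le> n" for j z
      using False that by (auto simp: f1_def)
    have "eventually (\<lambda>z. f1 k z = (z - a) ^ r * h z) (at a)"
      using Suc.prems(3) eventually_at_ball[of 1 a UNIV, OF zero_less_one] eventually_neq_at_within[of a a UNIV]
      by eventually_elim (simp add: f1_def)
    from Suc.IH[of f1, OF hol Suc.prems(2) this Suc.prems(4,5)]
    obtain m g where g: "\<forall>j\<le>n. g j holomorphic_on UNIV" "\<forall>j\<le>n. \<forall>z. f1 j z = (z - a) ^ m * g j z"
      "\<exists>j\<le>n. g j a \<noteq> 0" by blast
    show ?thesis using g f1 by (intro exI[of _ "Suc m"] exI[of _ g]) auto
  qed
qed

lemma common_zeros_removable:
  fixes f :: "nat \<Rightarrow> complex \<Rightarrow> complex"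
  assumes hol: "\<And>j. j \<le> n \<Longrightarrow> f j holomorphic_on UNIV" and k: "k \<le> n" "f k w \<noteq> 0"
  shows "\<exists>m g. (\<forall>j\<le>n. g j holomorphic_on UNIV) \<and> (\<forall>j\<le>n. \<forall>z. f j z = (z - a) ^ m * g j z)
           \<and> (\<exists>j\<le>n. g j a \<noteq> 0)"
proof -
  obtain e where e: "e > 0" "zor_poly (f k) a holomorphic_on cball a e"
    "\<forall>z\<in>cball a e. f k z = zor_poly (f k) a z * (z - a) ^ nat (zorder (f k) a) \<and> zor_poly (f k) a z \<noteq> 0"
    using zorder_exist_zero[OF hol[OF k(1)] open_UNIV connected_UNIV UNIV_I, of a] k(2) by blast
  have "continuous_on (ball a e) (zor_poly (f k) a)"
    by (rule continuous_on_subset[OF holomorphic_on_imp_continuous_on[OF e(2)] ball_subset_cball])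
  then have cont: "isCont (zor_poly (f k) a) a"
    using e(1) by (simp add: continuous_on_eq_continuous_at)
  have ev: "eventually (\<lambda>z. f k z = (z - a) ^ nat (zorder (f k) a) * zor_poly (f k) a z) (at a)"
    using eventually_at_ball[OF e(1), of a UNIV]
    by eventually_elim (use e(3) ball_subset_cball in \<open>auto simp: mult.commute\<close>)
  show ?thesis
    by (rule common_zero_factorization[of n f k, OF hol k(1) ev cont]) (use e in auto)
qed

text \<open>
  After common zeros at \<open>a\<close> are removed the density is continuous at \<open>a\<close>, and the removal
  changes it at most at \<open>a\<close> itself.
\<close>

lemma zero_density_locally_bounded:
  assumes hol: "\<And>j. j \<le> n \<Longrightarrow> f j holomorphic_on UNIV" and k: "k \<le> n" "f k w \<noteq> 0"
  shows "\<exists>W M. open W \<and> a \<in> W \<and> (\<forall>z\<in>W. zero_density f n z \<le> M)"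
proof -
  obtain m g where g: "\<forall>j\<le>n. g j holomorphic_on UNIV" "\<forall>j\<le>n. \<forall>z. f j z = (z - a) ^ m * g j z"
      "\<exists>j\<le>n. g j a \<noteq> 0"
    using common_zeros_removable[of n f k w a, OF hol k] by blast
  have "(\<Sum>j\<le>n. (cmod (g j a))\<^sup>2) \<noteq> 0" using g(3) by (auto simp: sum_nonneg_eq_0_iff)
  then have "isCont (zero_density g n) a"
    unfolding zero_density_eq_gram[abs_def] gram_def
    using g(1) by (intro continuous_intros) (auto intro!: isCont_entire)
  then have "eventually (\<lambda>z. zero_density g n z < zero_density g n a + 1) (at a)"
    unfolding isCont_def by (rule order_tendstoD) simp
  then obtain W where W: "open W" "a \<in> W" "\<And>z. z \<in> W \<Longrightarrow> z \<noteq> a \<Longrightarrow> zero_density g n z < zero_density g n a + 1"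
    unfolding eventually_at_topological by blast
  define M where "M = max (zero_density f n a) (zero_density g n a + 1)"
  have "zero_density f n z \<le> M" if "z \<in> W" for z
  proof (cases "z = a")
    case False
    have "zero_density f n z = zero_density g n z"
    proof (rule zero_density_common_factor[where q = "\<lambda>z. (z - a) ^ m"])
      show "(\<lambda>z. (z - a) ^ m) field_differentiable at z"
        by (intro derivative_intros)
      show "g j field_differentiable at z" if "j \<le> n" for j
        using g(1) that by (intro holomorphic_on_imp_differentiable_at[OF _ open_UNIV UNIV_I]) simp
    qed (use g(2) False in auto)
    then show ?thesis using W(3)[OF that False] by (simp add: M_def)
  qed (simp add: M_def)
  then show ?thesis using W(1,2) by (intro exI[of _ W] exI[of _ M]) simp
qed

lemma zero_density_bounded:
  assumes hol: "\<And>j. j \<le> n \<Longrightarrow> f j holomorphic_on UNIV" and k: "k \<le> n" "f k w \<noteq> 0"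
    and "bounded \<Omega>"
  shows "\<exists>M. \<forall>z\<in>\<Omega>. zero_density f n z \<le> M"
proof -
  have "\<forall>a. \<exists>WM. open (fst WM) \<and> a \<in> fst WM \<and> (\<forall>z\<in>fst WM. zero_density f n z \<le> snd WM)"
    using zero_density_locally_bounded[of n f k w, OF hol k] by simp
  then obtain WM where "\<forall>a. open (fst (WM a)) \<and> a \<in> fst (WM a) \<and> (\<forall>z\<in>fst (WM a). zero_density f n z \<le> snd (WM a))"
    by (rule choice[THEN exE])
  moreover define W M where "W a = fst (WM a)" "M a = snd (WM a)" for a
  ultimately have W: "\<And>a. open (W a)" "\<And>a. a \<in> W a" "\<And>a z. z \<in> W a \<Longrightarrow> zero_density f n z \<le> M a"
    by auto
  have comp: "compact (closure \<Omega>)" using assms(4) by simp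
  have cover: "closure \<Omega> \<subseteq> (\<Union>a\<in>closure \<Omega>. W a)" using W(2) by blast
  obtain C where C: "C \<subseteq> closure \<Omega>" "finite C" "closure \<Omega> \<subseteq> (\<Union>a\<in>C. W a)"
    by (rule compactE_image[OF comp W(1) cover], rule that)
  have "zero_density f n z \<le> (\<Sum>a\<in>C. \<bar>M a\<bar>)" if z: "z \<in> \<Omega>" for z
  proof -
    have "z \<in> closure \<Omega>" using z closure_subset[of \<Omega>] by (rule subsetD[rotated])
    then have "z \<in> (\<Union>a\<in>C. W a)" by (rule subsetD[OF C(3)])
    then obtain a where a: "a \<in> C" "z \<in> W a" by blast
    have "zero_density f n z \<le> \<bar>M a\<bar>" using W(3)[OF a(2)] by linarith
    also have "\<dots> \<le> (\<Sum>a\<in>C. \<bar>M a\<bar>)" using a(1) C(2) by (intro member_le_sum) auto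
    finally show ?thesis .
  qed
  then show ?thesis by (intro exI[of _ "\<Sum>a\<in>C. \<bar>M a\<bar>"] ballI)
qed

lemma borel_measurable_entire:
  assumes "g holomorphic_on UNIV"
  shows "g \<in> borel_measurable borel" "deriv g \<in> borel_measurable borel"
  by (intro borel_measurable_continuous_onI holomorphic_on_imp_continuous_on
      holomorphic_deriv assms open_UNIV)+

lemma borel_measurable_zero_density:
  assumes hol: "\<And>j. j \<le> n \<Longrightarrow> f j holomorphic_on UNIV"
  shows "zero_density f n \<in> borel_measurable borel"
proof -
  have [measurable]: "f j \<in> borel_measurable borel" "deriv (f j) \<in> borel_measurable borel" if "j \<in> {..n}" for j
    using that by (auto intro: borel_measurable_entire[OF hol])
  have [measurable]: "cnj \<in> borel_measurable borel"
    by (rule borel_measurable_continuous_onI[OF continuous_on_cnj[OF continuous_on_id]])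
  show ?thesis unfolding zero_density_eq_gram[abs_def] gram_def by measurable
qed

lemma set_integrable_zero_density:
  assumes hol: "\<And>j. j \<le> n \<Longrightarrow> f j holomorphic_on UNIV" and k: "k \<le> n" "f k w \<noteq> 0"
    and \<Omega>: "open \<Omega>" "bounded \<Omega>"
  shows "set_integrable lborel \<Omega> (zero_density f n)"
proof -
  obtain M where M: "\<And>z. z \<in> \<Omega> \<Longrightarrow> zero_density f n z \<le> M"
    using zero_density_bounded[of n f k w, OF hol k \<Omega>(2)] by blast
  show ?thesis unfolding set_integrable_def
  proof (rule integrableI_bounded_set_indicator)
    show "emeasure lborel \<Omega> < \<infinity>" using emeasure_bounded_finite[OF \<Omega>(2)] by simp
    show "AE z in lborel. z \<in> \<Omega> \<longrightarrow> norm (zero_density f n z) \<le> M"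
      using M by (intro AE_I2 impI) (simp add: zero_density_nonneg)
    show "zero_density f n \<in> borel_measurable lborel"
      using borel_measurable_zero_density[of n f, OF hol] by simp
  qed (use \<Omega>(1) in simp)
qed

section \<open>The law of the coefficients\<close>

text \<open>
  A plane Gaussian is a product of its coordinates; it suffices to compare both sides on
  rectangles.
\<close>

lemma pair_density_eq_distr_std_cgauss:
  "density lborel std_normal_density \<Otimes>\<^sub>M density lborel std_normal_density
    = distr std_cgauss (borel \<Otimes>\<^sub>M borel) (\<lambda>z. (Re z, Im z))"
proof (rule pair_measure_eqI)
  have "sigma_finite_measure (density lborel std_normal_density)"
    by (rule prob_space_imp_sigma_finite) (simp add: prob_space_normal_density)
  then show "sigma_finite_measure (density lborel std_normal_density)"
    "sigma_finite_measure (density lborel std_normal_density)" by simp_all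
  show "sets (density lborel (\<lambda>x. ennreal (std_normal_density x)) \<Otimes>\<^sub>M density lborel (\<lambda>x. ennreal (std_normal_density x)))
      = sets (distr std_cgauss (borel \<Otimes>\<^sub>M borel) (\<lambda>z. (Re z, Im z)))"
    by simp
next
  fix A B :: "real set"
  assume "A \<in> sets (density lborel (\<lambda>x. ennreal (std_normal_density x)))"
    "B \<in> sets (density lborel (\<lambda>x. ennreal (std_normal_density x)))"
  then have [measurable]: "A \<in> sets borel" "B \<in> sets borel" by auto
  let ?p = "\<lambda>A x. std_normal_density x * indicator A x"
  have e: "emeasure (density lborel std_normal_density) A = (\<integral>\<^sup>+x. ennreal (?p A x) \<partial>lborel)"
    if [measurable]: "A \<in> sets borel" for A :: "real set"
    by (auto simp: emeasure_density indicator_def intro!: nn_integral_cong)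
  have pre: "(\<lambda>z. (Re z, Im z)) -` (A \<times> B) = {z. Re z \<in> A \<and> Im z \<in> B}" by auto
  have [measurable]: "{z. Re z \<in> A \<and> Im z \<in> B} \<in> sets borel" by measurable
  have "emeasure (distr std_cgauss (borel \<Otimes>\<^sub>M borel) (\<lambda>z. (Re z, Im z))) (A \<times> B)
      = emeasure std_cgauss {z. Re z \<in> A \<and> Im z \<in> B}"
    by (subst emeasure_distr) (auto simp: pre)
  also have "\<dots> = (\<integral>\<^sup>+z. ennreal (?p A (Re z) * ?p B (Im z)) \<partial>lborel)"
    unfolding std_cgauss_def
    by (auto simp: emeasure_density cgauss_eq_normal_density indicator_def intro!: nn_integral_cong)
  also have "\<dots> = (\<integral>\<^sup>+x. ennreal (?p A x) \<partial>lborel) * (\<integral>\<^sup>+x. ennreal (?p B x) \<partial>lborel)"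
    by (rule nn_integral_Re_Im) auto
  finally show "emeasure (density lborel std_normal_density) A * emeasure (density lborel std_normal_density) B
      = emeasure (distr std_cgauss (borel \<Otimes>\<^sub>M borel) (\<lambda>z. (Re z, Im z))) (A \<times> B)"
    by (simp add: e)
qed

lemma measurable_Complex [measurable (raw)]:
  assumes [measurable]: "f \<in> borel_measurable M" "g \<in> borel_measurable M"
  shows "(\<lambda>x. Complex (f x) (g x)) \<in> borel_measurable M"
  unfolding Complex_eq by measurable

text \<open>
  Grouping the \<open>2 * n + 2\<close> real variables into pairs keeps independence, and each pair has law
  \<open>std_cgauss\<close>.
\<close>

lemma (in prob_space) distr_complex_normal_family:
  fixes \<alpha> \<beta> :: "nat \<Rightarrow> 'a \<Rightarrow> real"
  assumes indep: "indep_vars (\<lambda>_. borel) (case_sum \<alpha> \<beta>) ({..n} <+> {..n})"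
    and \<alpha>: "\<And>j. j \<le> n \<Longrightarrow> distributed M lborel (\<alpha> j) std_normal_density"
    and \<beta>: "\<And>j. j \<le> n \<Longrightarrow> distributed M lborel (\<beta> j) std_normal_density"
  shows "distr M (PiM {..n} (\<lambda>_. borel)) (\<lambda>\<omega>. \<lambda>j\<in>{..n}. Complex (\<alpha> j \<omega>) (\<beta> j \<omega>))
    = PiM {..n} (\<lambda>_. std_cgauss)"
proof -
  define \<eta> where "\<eta> j \<omega> = Complex (\<alpha> j \<omega>) (\<beta> j \<omega>)" for j \<omega>
  let ?K = "\<lambda>j::nat. {Inl j, Inr j :: nat + nat}"
  have rv: "\<alpha> j \<in> borel_measurable M" "\<beta> j \<in> borel_measurable M" if "j \<le> n" for j
    using distributed_measurable[OF \<alpha>[OF that]] distributed_measurable[OF \<beta>[OF that]] by simp_all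
  have "indep_vars (\<lambda>j. PiM (?K j) (\<lambda>_. borel)) (\<lambda>j \<omega>. restrict (\<lambda>i. case_sum \<alpha> \<beta> i \<omega>) (?K j)) {..n}"
    by (rule indep_vars_restrict[OF indep]) (auto simp: disjoint_family_on_def)
  then have "indep_vars (\<lambda>_. borel)
      (\<lambda>j \<omega>. (\<lambda>x. Complex (x (Inl j)) (x (Inr j))) (restrict (\<lambda>i. case_sum \<alpha> \<beta> i \<omega>) (?K j))) {..n}"
    by (rule indep_vars_compose2) measurable
  then have ind: "indep_vars (\<lambda>_. borel) \<eta> {..n}"
    by (simp add: \<eta>_def[abs_def])
  have marginal: "distr M borel (\<eta> j) = std_cgauss" if j: "j \<le> n" for j
  proof -
    have borel_eq: "distr M borel X = distr M lborel X" for X :: "'a \<Rightarrow> real"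
      by (rule distr_cong) simp_all
    have d: "distr M borel (\<alpha> j) = density lborel std_normal_density"
      "distr M borel (\<beta> j) = density lborel std_normal_density"
      unfolding borel_eq
      using distributed_distr_eq_density[OF \<alpha>[OF j]] distributed_distr_eq_density[OF \<beta>[OF j]] by simp_all
    have "indep_vars (\<lambda>_. borel) (case_sum \<alpha> \<beta>) (?K j)"
      using j by (intro indep_vars_subset[OF indep]) auto
    then have "distr M (PiM (?K j) (\<lambda>_. borel)) (\<lambda>\<omega>. \<lambda>i\<in>?K j. case_sum \<alpha> \<beta> i \<omega>)
        = PiM (?K j) (\<lambda>i. distr M borel (case_sum \<alpha> \<beta> i))"
      by (rule indep_vars_iff_distr_eq_PiM'[THEN iffD1, rotated 2]) (use rv[OF j] in auto)
    also have "\<dots> = PiM (?K j) (\<lambda>_. density lborel std_normal_density)"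
      by (rule PiM_cong) (auto simp: d)
    finally have joint: "distr M (PiM (?K j) (\<lambda>_. borel)) (\<lambda>\<omega>. \<lambda>i\<in>?K j. case_sum \<alpha> \<beta> i \<omega>)
        = PiM (?K j) (\<lambda>_. density lborel std_normal_density)" .
    interpret product_sigma_finite "\<lambda>_::nat + nat. density lborel (\<lambda>x. ennreal (std_normal_density x))"
      unfolding product_sigma_finite_def
      by (auto intro!: prob_space_imp_sigma_finite simp: prob_space_normal_density)
    have [measurable]: "\<alpha> j \<in> borel_measurable M" "\<beta> j \<in> borel_measurable M" using rv[OF j] by auto
    show ?thesis
    proof (rule measure_eqI)
      fix A assume "A \<in> sets (distr M borel (\<eta> j))"
      then have [measurable]: "A \<in> sets borel" by simp
      have "emeasure (distr M borel (\<eta> j)) A = (\<integral>\<^sup>+\<omega>. indicator A (\<eta> j \<omega>) \<partial>M)"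
      proof -
        have [measurable]: "\<eta> j \<in> borel_measurable M" unfolding \<eta>_def by measurable
        have "emeasure (distr M borel (\<eta> j)) A = (\<integral>\<^sup>+x. indicator A x \<partial>distr M borel (\<eta> j))"
          by simp
        also have "\<dots> = (\<integral>\<^sup>+\<omega>. indicator A (\<eta> j \<omega>) \<partial>M)" by (rule nn_integral_distr) auto
        finally show ?thesis .
      qed
      also have "\<dots> = (\<integral>\<^sup>+x. indicator A (Complex (x (Inl j)) (x (Inr j)))
          \<partial>distr M (PiM (?K j) (\<lambda>_. borel)) (\<lambda>\<omega>. \<lambda>i\<in>?K j. case_sum \<alpha> \<beta> i \<omega>))"
      proof (subst nn_integral_distr)
        show "(\<lambda>\<omega>. \<lambda>i\<in>?K j. case_sum \<alpha> \<beta> i \<omega>) \<in> measurable M (PiM (?K j) (\<lambda>_. borel))"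
          by (rule measurable_restrict) (use rv[OF j] in auto)
      qed (simp_all add: \<eta>_def)
      \<comment> \<open>From the product over the two-element index set to a pair measure.\<close>
      also have "\<dots> = (\<integral>\<^sup>+z. indicator A (Complex (fst z) (snd z))
          \<partial>(density lborel std_normal_density \<Otimes>\<^sub>M density lborel std_normal_density))"
        unfolding joint by (rule product_nn_integral_pair) (auto simp: split_beta')
      also have "\<dots> = (\<integral>\<^sup>+z. indicator A z \<partial>std_cgauss)"
        unfolding pair_density_eq_distr_std_cgauss by (subst nn_integral_distr) auto
      finally show "emeasure (distr M borel (\<eta> j)) A = emeasure std_cgauss A" by simp
    qed simp
  qed
  have "distr M (PiM {..n} (\<lambda>_. borel)) (\<lambda>\<omega>. \<lambda>j\<in>{..n}. \<eta> j \<omega>) = PiM {..n} (\<lambda>j. distr M borel (\<eta> j))"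
  proof (rule indep_vars_iff_distr_eq_PiM'[THEN iffD1, OF _ _ ind])
    show "\<eta> j \<in> borel_measurable M" if "j \<in> {..n}" for j
      unfolding \<eta>_def using rv[of j] that by (intro measurable_Complex) simp_all
  qed simp
  also have "\<dots> = PiM {..n} (\<lambda>_. std_cgauss)"
    by (rule PiM_cong) (auto simp: marginal)
  finally show ?thesis by (simp add: \<eta>_def)
qed

lemma AE_std_cgauss_if_AE_lborel:
  assumes "AE w in lborel. P w"
  shows "AE w in std_cgauss. P w"
  using assms unfolding std_cgauss_def by (subst AE_density) auto

text \<open>
  For fixed values of the other coordinates at most one value of the \<open>i\<close>-th one annihilates the
  form.
\<close>

lemma AE_PiM_std_cgauss_linear_nonzero:
  fixes a :: "'i \<Rightarrow> complex"
  assumes I: "finite I" and i: "i \<in> I" "a i \<noteq> 0"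
  shows "AE c in PiM I (\<lambda>_. std_cgauss). (\<Sum>j\<in>I. c j * a j) \<noteq> 0"
proof -
  interpret product_sigma_finite "\<lambda>_. std_cgauss" by (rule product_sigma_finite_std_cgauss)
  define J where "J = I - {i}"
  have J: "finite J" "i \<notin> J" "I = insert i J" using I i(1) by (auto simp: J_def)
  let ?P = "PiM I (\<lambda>_. std_cgauss)"
  let ?Z = "{c \<in> space ?P. (\<Sum>j\<in>I. c j * a j) = 0}"
  have Z: "?Z \<in> sets ?P" using I by measurable
  have "emeasure ?P ?Z = (\<integral>\<^sup>+c. indicator ?Z c \<partial>?P)" using Z by simp
  also have "\<dots> = (\<integral>\<^sup>+x. \<integral>\<^sup>+y. indicator ?Z (x(i := y)) \<partial>std_cgauss \<partial>PiM J (\<lambda>_. std_cgauss))"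
    using Z unfolding J(3) by (intro product_nn_integral_insert J(1,2)) simp
  also have "\<dots> = (\<integral>\<^sup>+x. 0 \<partial>PiM J (\<lambda>_. std_cgauss))"
  proof (intro nn_integral_cong)
    fix x :: "'i \<Rightarrow> complex"
    have "indicator ?Z (x(i := y)) = (0::ennreal)" if y: "y \<noteq> - (\<Sum>j\<in>J. x j * a j) / a i" for y
    proof -
      have "(\<Sum>j\<in>I. (x(i := y)) j * a j) = y * a i + (\<Sum>j\<in>J. (x(i := y)) j * a j)"
        using J by simp
      also have "(\<Sum>j\<in>J. (x(i := y)) j * a j) = (\<Sum>j\<in>J. x j * a j)"
        using J(2) by (intro sum.cong) auto
      finally have sum_eq: "(\<Sum>j\<in>I. (x(i := y)) j * a j) = y * a i + (\<Sum>j\<in>J. x j * a j)" .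
      have "(\<Sum>j\<in>I. (x(i := y)) j * a j) \<noteq> 0"
      proof
        assume "(\<Sum>j\<in>I. (x(i := y)) j * a j) = 0"
        then have "y * a i = - (\<Sum>j\<in>J. x j * a j)"
          unfolding sum_eq by (simp only: eq_neg_iff_add_eq_0)
        then have "y = - (\<Sum>j\<in>J. x j * a j) / a i" by (rule eq_divide_imp[OF i(2)])
        with y show False by contradiction
      qed
      then show ?thesis by simp
    qed
    then have "AE y in std_cgauss. indicator ?Z (x(i := y)) = (0::ennreal)"
      by (rule eventually_mono[OF AE_std_cgauss_if_AE_lborel[OF AE_lborel_singleton]])
    then have "(\<integral>\<^sup>+y. indicator ?Z (x(i := y)) \<partial>std_cgauss) = (\<integral>\<^sup>+y. 0 \<partial>std_cgauss)"
      by (rule nn_integral_cong_AE)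
    then show "(\<integral>\<^sup>+y. indicator ?Z (x(i := y)) \<partial>std_cgauss) = 0" by simp
  qed
  finally have "emeasure ?P ?Z = 0" by simp
  then have "?Z \<in> null_sets ?P" using Z by (rule null_setsI)
  then show ?thesis by (rule AE_I') blast
qed

section \<open>The expected number of zeros\<close>

text \<open>
  The coefficients are extended by zero so that \<open>borel_measurable_zero_count\<close> applies.
\<close>

lemma borel_measurable_zero_count_PiM:
  assumes hol: "\<And>j. j \<le> n \<Longrightarrow> f j holomorphic_on UNIV" and \<Omega>: "open \<Omega>" "bounded \<Omega>"
  shows "(\<lambda>c. zero_count (lin_comb f n c) \<Omega>) \<in> borel_measurable (PiM {..n} (\<lambda>_. borel))"
proof -
  have "(\<lambda>c j. if j \<in> {..n} then c j else 0) \<in> borel_measurable (PiM {..n} (\<lambda>_. borel :: complex measure))"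
  proof (rule measurable_coordinatewise_then_product)
    fix j show "(\<lambda>c. if j \<in> {..n} then c j else 0) \<in> borel_measurable (PiM {..n} (\<lambda>_. borel :: complex measure))"
      by (cases "j \<in> {..n}") simp_all
  qed
  from measurable_compose[OF this borel_measurable_zero_count[of n f, OF hol \<Omega>]]
  have "(\<lambda>c. zero_count (lin_comb f n (\<lambda>j. if j \<in> {..n} then c j else 0)) \<Omega>)
      \<in> borel_measurable (PiM {..n} (\<lambda>_. borel))" by simp
  moreover have "lin_comb f n (\<lambda>j. if j \<in> {..n} then c j else 0) = lin_comb f n c" for c
    by (simp add: lin_comb_def fun_eq_iff)
  ultimately show ?thesis by simp
qed

text \<open>
  Infinitely many zeros are allowed: both sides are then infinite.
\<close>

lemma zero_count_simple_zeros:
  assumes hol: "p holomorphic_on UNIV"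
    and simple: "\<And>z. z \<in> \<Omega> \<Longrightarrow> p z = 0 \<Longrightarrow> deriv p z \<noteq> 0"
  shows "zero_count p \<Omega> = emeasure (count_space UNIV) {z \<in> \<Omega>. p z = 0}"
proof -
  have "zorder p z = 1" if "z \<in> \<Omega>" "p z = 0" for z
    by (rule zorder_zero_eqI[OF hol open_UNIV UNIV_I]) (use simple that in auto)
  then have "(\<Sum>z\<in>{z \<in> \<Omega>. p z = 0}. nat (zorder p z)) = (\<Sum>z\<in>{z \<in> \<Omega>. p z = 0}. 1)"
    by (intro sum.cong) auto
  then show ?thesis by (auto simp: zero_count_def)
qed

text \<open>
  The zeros of \<open>y * g + Q\<close> off the zeros of \<open>g\<close> are the points where \<open>ratio = - Q / g\<close> takes the
  value \<open>y\<close>. At zeros of \<open>g\<close> the totalized division makes \<open>ratio\<close> and \<open>ratio'\<close> equal to 0, which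
  keeps both Borel measurable on the whole plane.
\<close>

locale quotient_by_entire =
  fixes g Q :: "complex \<Rightarrow> complex"
  assumes g: "g holomorphic_on UNIV" and Q: "Q holomorphic_on UNIV" and g_nonzero: "\<exists>w. g w \<noteq> 0"
begin

definition ratio where "ratio z = - Q z / g z"

definition ratio' where "ratio' z = - (deriv Q z * g z - Q z * deriv g z) / (g z)\<^sup>2"

lemma has_field_derivative_ratio:
  assumes "g z \<noteq> 0"
  shows "(ratio has_field_derivative ratio' z) (at z)"
proof -
  have "(Q has_field_derivative deriv Q z) (at z)" "(g has_field_derivative deriv g z) (at z)"
    using g Q by (auto intro: holomorphic_derivI)
  then show ?thesis
    unfolding ratio_def ratio'_def using assms
    by (auto intro!: derivative_eq_intros simp: field_simps power2_eq_square)
qed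

lemma borel_measurable_ratio: "ratio \<in> borel_measurable borel" "ratio' \<in> borel_measurable borel"
proof -
  note [measurable] = borel_measurable_entire[OF g] borel_measurable_entire[OF Q]
  show "ratio \<in> borel_measurable borel" "ratio' \<in> borel_measurable borel"
    unfolding ratio_def[abs_def] ratio'_def[abs_def] by measurable
qed

text \<open>
  The critical points are zeros of the entire function \<open>Q' * g - Q * g'\<close>. Either this function
  is not identically zero and has finitely many zeros in a bounded set, or the ratio is constant
  where \<open>g\<close> is nonzero, because removing the countably many zeros of \<open>g\<close> leaves the plane
  connected.
\<close>

lemma countable_critical_values:
  assumes "bounded \<Omega>"
  shows "countable (ratio ` {z \<in> \<Omega>. g z \<noteq> 0 \<and> ratio' z = 0})"
proof (cases "\<exists>v. deriv Q v * g v - Q v * deriv g v \<noteq> 0")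
  case True
  then obtain v where v: "deriv Q v * g v - Q v * deriv g v \<noteq> 0" by blast
  have "(\<lambda>z. deriv Q z * g z - Q z * deriv g z) holomorphic_on UNIV"
    by (intro holomorphic_intros g Q holomorphic_deriv open_UNIV)
  from finite_zeros_entire[OF this v assms]
  have "finite {z \<in> \<Omega>. deriv Q z * g z - Q z * deriv g z = 0}" .
  then have "finite {z \<in> \<Omega>. g z \<noteq> 0 \<and> ratio' z = 0}"
    by (rule rev_finite_subset) (auto simp: ratio'_def)
  then show ?thesis by (intro countable_finite finite_imageI)
next
  case False
  let ?V = "UNIV - {z. g z = 0}"
  have "countable {z. g z = 0}"
  proof (cases "g constant_on UNIV")
    case True
    then have "{z. g z = 0} = {}" using g_nonzero by (auto simp: constant_on_def)
    then show ?thesis by simp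
  next
    case nc: False
    have "countable {z \<in> UNIV. g z = 0}"
      using nc by (intro holomorphic_countable_zeros[OF g]) auto
    then show ?thesis by simp
  qed
  then have conn: "connected ?V"
    by (intro connected_open_diff_countable) auto
  have "continuous_on UNIV g" by (rule holomorphic_on_imp_continuous_on[OF g])
  then have "closed {z. g z = 0}" by (intro closed_Collect_eq) auto
  then have op: "open ?V" by (intro open_Diff) auto
  have "ratio' z = 0" for z using False by (simp add: ratio'_def)
  then have "(ratio has_field_derivative 0) (at z)" if "z \<in> ?V" for z
    using has_field_derivative_ratio[of z] that by simp
  then have "ratio constant_on ?V"
    by (rule has_field_derivative_0_imp_constant_on[OF _ conn op])
  then obtain y where y: "\<And>z. z \<in> ?V \<Longrightarrow> ratio z = y" by (auto simp: constant_on_def)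
  have "ratio ` {z \<in> \<Omega>. g z \<noteq> 0 \<and> ratio' z = 0} \<subseteq> {y}" using y by auto
  then show ?thesis by (rule countable_subset) simp
qed

text \<open>
  At a zero of \<open>y * g + Q\<close> the derivative is \<open>- g * ratio'\<close>, so for all \<open>y\<close> outside the
  countable set of critical values every zero is simple and the count is the one in the area
  formula.
\<close>

lemma nn_integral_zero_count:
  assumes \<Omega>: "open \<Omega>" "bounded \<Omega>" and no_common: "\<And>z. z \<in> \<Omega> \<Longrightarrow> g z = 0 \<Longrightarrow> Q z \<noteq> 0"
  shows "(\<integral>\<^sup>+y. zero_count (\<lambda>z. y * g z + Q z) \<Omega> \<partial>std_cgauss)
    = (\<integral>\<^sup>+z\<in>{z \<in> \<Omega>. g z \<noteq> 0}. ennreal (cgauss 1 (ratio z) * (cmod (ratio' z))\<^sup>2) \<partial>lborel)"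
proof -
  let ?U = "{z \<in> \<Omega>. g z \<noteq> 0}" and ?C = "ratio ` {z \<in> \<Omega>. g z \<noteq> 0 \<and> ratio' z = 0}"
  let ?N = "\<lambda>y. emeasure (count_space UNIV) {z \<in> ?U. ratio' z \<noteq> 0 \<and> ratio z = y}"
  have "continuous_on UNIV g" by (rule holomorphic_on_imp_continuous_on[OF g])
  then have "open (\<Omega> \<inter> {z. g z \<noteq> 0})" using \<Omega>(1) by (intro open_Int open_Collect_neq) auto
  then have U: "open ?U" by (simp add: Int_def)
  have area: "?N \<in> borel_measurable borel"
    "(\<integral>\<^sup>+y. ennreal (cgauss 1 y) * ?N y \<partial>lborel)
      = (\<integral>\<^sup>+z\<in>?U. (ennreal (cgauss 1 (ratio z)) * ennreal ((cmod (ratio' z))\<^sup>2)) \<partial>lborel)"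
    using area_formula_holomorphic[OF U borel_measurable_ratio, of "\<lambda>y. ennreal (cgauss 1 y)"]
      has_field_derivative_ratio by simp_all
  have eq: "zero_count (\<lambda>z. y * g z + Q z) \<Omega> = ?N y" if y: "y \<notin> ?C" for y
  proof -
    let ?p = "\<lambda>z. y * g z + Q z"
    have zero_iff: "?p z = 0 \<longleftrightarrow> g z \<noteq> 0 \<and> ratio z = y" if "z \<in> \<Omega>" for z
    proof (cases "g z = 0")
      case False
      have "?p z = 0 \<longleftrightarrow> - Q z = y * g z" by (metis add.commute neg_eq_iff_add_eq_0)
      then show ?thesis using False unfolding ratio_def divide_eq_eq by simp
    qed (use no_common[OF that] in auto)
    have "deriv ?p z \<noteq> 0" if z: "z \<in> \<Omega>" "?p z = 0" for z
    proof -
      have gz: "g z \<noteq> 0" and Gz: "ratio z = y" using zero_iff[OF z(1)] z(2) by auto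
      have "(Q has_field_derivative deriv Q z) (at z)" "(g has_field_derivative deriv g z) (at z)"
        using g Q by (auto intro: holomorphic_derivI)
      then have "(?p has_field_derivative (y * deriv g z + deriv Q z)) (at z)"
        by (auto intro!: derivative_eq_intros)
      then have "deriv ?p z = y * deriv g z + deriv Q z" by (rule DERIV_imp_deriv)
      also have "\<dots> = - (g z * ratio' z)"
        using gz unfolding Gz[symmetric] ratio_def ratio'_def by (simp add: field_simps power2_eq_square)
      finally show ?thesis using gz Gz y z(1) by auto
    qed
    then have "zero_count ?p \<Omega> = emeasure (count_space UNIV) {z \<in> \<Omega>. ?p z = 0}"
      by (intro zero_count_simple_zeros holomorphic_intros g Q)
    also have "{z \<in> \<Omega>. ?p z = 0} = {z \<in> ?U. ratio' z \<noteq> 0 \<and> ratio z = y}"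
      using zero_iff y by auto
    finally show ?thesis .
  qed
  have "AE y in lborel. y \<notin> ?C"
    using countable_critical_values[OF \<Omega>(2)] by (intro AE_not_in countable_imp_null_set_lborel)
  then have "AE y in std_cgauss. zero_count (\<lambda>z. y * g z + Q z) \<Omega> = ?N y"
    by (rule eventually_mono[OF AE_std_cgauss_if_AE_lborel]) (rule eq)
  then have "(\<integral>\<^sup>+y. zero_count (\<lambda>z. y * g z + Q z) \<Omega> \<partial>std_cgauss) = (\<integral>\<^sup>+y. ?N y \<partial>std_cgauss)"
    by (rule nn_integral_cong_AE)
  also have "\<dots> = (\<integral>\<^sup>+y. ennreal (cgauss 1 y) * ?N y \<partial>lborel)"
    unfolding std_cgauss_def using area(1) by (intro nn_integral_density) auto
  also have "\<dots> = (\<integral>\<^sup>+z\<in>?U. ennreal (cgauss 1 (ratio z) * (cmod (ratio' z))\<^sup>2) \<partial>lborel)"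
    unfolding area(2) by (simp add: ennreal_mult' cgauss_nonneg)
  finally show ?thesis .
qed

end

text \<open>
  Dividing the vector of all \<open>f j\<close> by \<open>f k\<close> turns its \<open>k\<close>-th component into 1, whose derivative
  is 0; the remaining components are the coefficients \<open>- a j\<close> of the linear form for \<open>ratio\<close>,
  and their derivatives are the \<open>- b j\<close>.
\<close>

lemma zero_density_eq_quotient_form:
  fixes f :: "nat \<Rightarrow> complex \<Rightarrow> complex"
  assumes k: "k \<le> n" "f k z \<noteq> 0"
  defines "I \<equiv> {..n} - {k}"
  defines "a \<equiv> \<lambda>j. - f j z / f k z"
  defines "b \<equiv> \<lambda>j. - (deriv (f j) z * f k z - f j z * deriv (f k) z) / (f k z)\<^sup>2"
  shows "zero_density f n z = ((1 + (\<Sum>j\<in>I. (cmod (a j))\<^sup>2)) * (\<Sum>j\<in>I. (cmod (b j))\<^sup>2)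
      - (cmod (\<Sum>j\<in>I. cnj (a j) * b j))\<^sup>2) / (pi * (1 + (\<Sum>j\<in>I. (cmod (a j))\<^sup>2))\<^sup>2)"
proof -
  define A where "A j = (if j = k then 1 else - a j)" for j
  define B where "B j = (if j = k then 0 else - b j)" for j
  have n: "{..n} = insert k I" "finite I" "k \<notin> I" using k(1) by (auto simp: I_def)
  have fA: "f j z = f k z * A j" for j using k(2) by (simp add: A_def a_def)
  have fB: "deriv (f j) z = deriv (f k) z * A j + f k z * B j" for j
    using k(2) by (simp add: A_def B_def a_def b_def field_simps power2_eq_square)
  have sumA: "(\<Sum>j\<le>n. (cmod (A j))\<^sup>2) = 1 + (\<Sum>j\<in>I. (cmod (a j))\<^sup>2)"
    unfolding n(1) using n(2,3) by (auto simp: A_def intro!: sum.cong)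
  have sumB: "(\<Sum>j\<le>n. (cmod (B j))\<^sup>2) = (\<Sum>j\<in>I. (cmod (b j))\<^sup>2)"
    unfolding n(1) using n(2,3) by (auto simp: B_def intro!: sum.cong)
  have "(\<Sum>j\<le>n. A j * cnj (B j)) = cnj (\<Sum>j\<in>I. cnj (a j) * b j)"
    unfolding n(1) using n(2,3) by (auto simp: A_def B_def intro!: sum.cong)
  then have gramAB: "gram {..n} A B = (1 + (\<Sum>j\<in>I. (cmod (a j))\<^sup>2)) * (\<Sum>j\<in>I. (cmod (b j))\<^sup>2)
      - (cmod (\<Sum>j\<in>I. cnj (a j) * b j))\<^sup>2"
    unfolding gram_def sumA sumB by (simp only: complex_mod_cnj mult.commute)
  have 1: "gram {..n} (\<lambda>j. f j z) (\<lambda>j. deriv (f j) z) = (cmod (f k z))^4 * gram {..n} A B"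
    using gram_scale[of "{..n}" "f k z" A "deriv (f k) z" B] by (simp only: fA[symmetric] fB[symmetric])
  have "(\<Sum>j\<le>n. (cmod (f j z))\<^sup>2) = (\<Sum>j\<le>n. (cmod (f k z))\<^sup>2 * (cmod (A j))\<^sup>2)"
    by (intro sum.cong refl, subst fA) (simp add: norm_mult power_mult_distrib)
  then have "(\<Sum>j\<le>n. (cmod (f j z))\<^sup>2)\<^sup>2 = (cmod (f k z))^4 * (1 + (\<Sum>j\<in>I. (cmod (a j))\<^sup>2))\<^sup>2"
    by (simp only: sum_distrib_left[symmetric] sumA power_mult_distrib power_mult[symmetric]) simp
  then show ?thesis
    unfolding zero_density_eq_gram 1 gramAB using k(2) by (simp add: mult.left_commute)
qed

text \<open>
  The coefficient of \<open>f k\<close> is integrated first, by the area formula, and then the others,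
  pointwise in \<open>z\<close>.
\<close>

theorem nn_integral_zero_count_PiM:
  fixes f :: "nat \<Rightarrow> complex \<Rightarrow> complex"
  assumes hol: "\<And>j. j \<le> n \<Longrightarrow> f j holomorphic_on UNIV" and \<Omega>: "open \<Omega>" "bounded \<Omega>"
    and no_common: "\<And>z. z \<in> \<Omega> \<Longrightarrow> \<exists>j\<le>n. f j z \<noteq> 0"
    and k: "k \<le> n" "f k w \<noteq> 0"
  shows "(\<integral>\<^sup>+c. zero_count (lin_comb f n c) \<Omega> \<partial>PiM {..n} (\<lambda>_. std_cgauss))
    = (\<integral>\<^sup>+z\<in>\<Omega>. ennreal (zero_density f n z) \<partial>lborel)"
proof -
  interpret product_sigma_finite "\<lambda>_. std_cgauss" by (rule product_sigma_finite_std_cgauss)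
  define I where "I = {..n} - {k}"
  have I: "finite I" "k \<notin> I" "insert k I = {..n}" using k(1) by (auto simp: I_def)
  define Q where "Q c z = (\<Sum>j\<in>I. c j * f j z)" for c z
  define a where "a j z = - f j z / f k z" for j z
  define b where "b j z = - (deriv (f j) z * f k z - f j z * deriv (f k) z) / (f k z)\<^sup>2" for j z
  let ?P = "PiM I (\<lambda>_. std_cgauss)"
  let ?U = "{z \<in> \<Omega>. f k z \<noteq> 0}"
  have holk: "f k holomorphic_on UNIV" by (rule hol[OF k(1)])
  have holI: "f j holomorphic_on UNIV" if "j \<in> I" for j using that hol by (auto simp: I_def)
  have finZ: "finite {z \<in> \<Omega>. f k z = 0}" by (rule finite_zeros_entire[OF holk k(2) \<Omega>(2)])
  have holQ: "Q c holomorphic_on UNIV" for c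
    unfolding Q_def[abs_def] by (intro holomorphic_intros holI)
  have loc: "quotient_by_entire (f k) (Q c)" for c
    using holk holQ k(2) by (auto simp: quotient_by_entire_def)
  have derivQ: "deriv (Q c) z = (\<Sum>j\<in>I. c j * deriv (f j) z)" for c z
  proof (rule DERIV_imp_deriv)
    have "(f j has_field_derivative deriv (f j) z) (at z)" if "j \<in> I" for j
      using holI[OF that] by (auto intro: holomorphic_derivI)
    then show "(Q c has_field_derivative (\<Sum>j\<in>I. c j * deriv (f j) z)) (at z)"
      unfolding Q_def[abs_def] by (intro DERIV_sum DERIV_cmult)
  qed
  have ratio: "quotient_by_entire.ratio (f k) (Q c) z = (\<Sum>j\<in>I. c j * a j z)" for c z
    unfolding quotient_by_entire.ratio_def[OF loc] Q_def a_def
    by (simp add: sum_divide_distrib sum_negf)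
  have ratio': "quotient_by_entire.ratio' (f k) (Q c) z = (\<Sum>j\<in>I. c j * b j z)" for c z
  proof -
    have num: "deriv (Q c) z * f k z - Q c z * deriv (f k) z
        = (\<Sum>j\<in>I. c j * (deriv (f j) z * f k z - f j z * deriv (f k) z))"
      unfolding derivQ Q_def sum_distrib_right sum_subtractf[symmetric]
      by (intro sum.cong) (simp_all add: algebra_simps)
    show ?thesis
      unfolding quotient_by_entire.ratio'_def[OF loc] b_def num sum_negf[symmetric] sum_divide_distrib
      by (simp only: minus_mult_right times_divide_eq_right)
  qed
  have lin: "lin_comb f n (c(k := y)) = (\<lambda>z. y * f k z + Q c z)" for c y
  proof
    fix z
    have "(\<Sum>j\<in>I. (c(k := y)) j * f j z) = Q c z"
      unfolding Q_def using I(2) by (intro sum.cong) auto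
    then show "lin_comb f n (c(k := y)) z = y * f k z + Q c z"
      unfolding lin_comb_def I(3)[symmetric] using I(1,2) by simp
  qed
  \<comment> \<open>At a zero of \<open>f k\<close> the value of the combination is \<open>Q c z\<close>, whatever the \<open>k\<close>-th coefficient.\<close>
  have "AE c in ?P. \<forall>z\<in>{z \<in> \<Omega>. f k z = 0}. Q c z \<noteq> 0"
  proof (rule AE_finite_allI[OF finZ])
    fix z assume "z \<in> {z \<in> \<Omega>. f k z = 0}"
    then obtain i where "i \<in> I" "f i z \<noteq> 0" using no_common[of z] by (auto simp: I_def)
    then show "AE c in ?P. Q c z \<noteq> 0"
      unfolding Q_def by (intro AE_PiM_std_cgauss_linear_nonzero I(1))
  qed
  then have inner: "AE c in ?P. (\<integral>\<^sup>+y. zero_count (lin_comb f n (c(k := y))) \<Omega> \<partial>std_cgauss)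
      = (\<integral>\<^sup>+z\<in>?U. ennreal (cgauss 1 (\<Sum>j\<in>I. c j * a j z) * (cmod (\<Sum>j\<in>I. c j * b j z))\<^sup>2) \<partial>lborel)"
  proof (rule eventually_mono)
    fix c assume c: "\<forall>z\<in>{z \<in> \<Omega>. f k z = 0}. Q c z \<noteq> 0"
    show "(\<integral>\<^sup>+y. zero_count (lin_comb f n (c(k := y))) \<Omega> \<partial>std_cgauss)
      = (\<integral>\<^sup>+z\<in>?U. ennreal (cgauss 1 (\<Sum>j\<in>I. c j * a j z) * (cmod (\<Sum>j\<in>I. c j * b j z))\<^sup>2) \<partial>lborel)"
      unfolding lin ratio[symmetric] ratio'[symmetric]
      by (rule quotient_by_entire.nn_integral_zero_count[OF loc \<Omega>]) (use c in auto)
  qed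
  have sets: "sets (PiM {..n} (\<lambda>_. std_cgauss)) = sets (PiM {..n} (\<lambda>_. borel))"
    by (rule sets_PiM_cong) simp_all
  have F: "(\<lambda>c. zero_count (lin_comb f n c) \<Omega>) \<in> borel_measurable (PiM (insert k I) (\<lambda>_. std_cgauss))"
    unfolding I(3) measurable_cong_sets[OF sets refl]
    by (rule borel_measurable_zero_count_PiM[of n f, OF hol \<Omega>])
  have [measurable]: "f k \<in> borel_measurable borel" "deriv (f k) \<in> borel_measurable borel"
    by (rule borel_measurable_entire[OF holk])+
  have [measurable]: "f j \<in> borel_measurable borel" "deriv (f j) \<in> borel_measurable borel" if "j \<in> I" for j
    by (rule borel_measurable_entire[OF holI[OF that]])+
  have [measurable]: "a j \<in> borel_measurable borel" "b j \<in> borel_measurable borel" if "j \<in> I" for j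
    using that unfolding a_def[abs_def] b_def[abs_def] by measurable
  have [measurable]: "\<Omega> \<in> sets borel" using \<Omega>(1) by simp
  have U [measurable]: "?U \<in> sets borel" by measurable
  interpret PI: prob_space ?P by (rule prob_space_PiM) (rule prob_space_std_cgauss)
  interpret pair: pair_sigma_finite ?P lborel ..
  have "(\<integral>\<^sup>+c. zero_count (lin_comb f n c) \<Omega> \<partial>PiM {..n} (\<lambda>_. std_cgauss))
      = (\<integral>\<^sup>+c. \<integral>\<^sup>+y. zero_count (lin_comb f n (c(k := y))) \<Omega> \<partial>std_cgauss \<partial>?P)"
    unfolding I(3)[symmetric] by (rule product_nn_integral_insert[OF I(1,2) F])
  also have "\<dots> = (\<integral>\<^sup>+c. (\<integral>\<^sup>+z\<in>?U. ennreal (cgauss 1 (\<Sum>j\<in>I. c j * a j z) * (cmod (\<Sum>j\<in>I. c j * b j z))\<^sup>2) \<partial>lborel) \<partial>?P)"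
    by (rule nn_integral_cong_AE[OF inner])
  also have "\<dots> = (\<integral>\<^sup>+z. \<integral>\<^sup>+c. ennreal (cgauss 1 (\<Sum>j\<in>I. c j * a j z) * (cmod (\<Sum>j\<in>I. c j * b j z))\<^sup>2) * indicator ?U z \<partial>?P \<partial>lborel)"
    by (rule pair.Fubini'[symmetric]) measurable
  also have "\<dots> = (\<integral>\<^sup>+z\<in>?U. ennreal (zero_density f n z) \<partial>lborel)"
  proof (rule nn_integral_cong)
    fix z
    have "(\<integral>\<^sup>+c. ennreal (cgauss 1 (\<Sum>j\<in>I. c j * a j z) * (cmod (\<Sum>j\<in>I. c j * b j z))\<^sup>2) * indicator ?U z \<partial>?P)
      = (\<integral>\<^sup>+c. ennreal (cgauss 1 (\<Sum>j\<in>I. c j * a j z) * (cmod (\<Sum>j\<in>I. c j * b j z))\<^sup>2) \<partial>?P) * indicator ?U z"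
      by (rule nn_integral_multc) measurable
    also have "\<dots> = ennreal (zero_density f n z) * indicator ?U z"
    proof (cases "f k z = 0")
      case False
      show ?thesis
        unfolding nn_integral_PiM_std_cgauss[OF I(1)]
        unfolding a_def b_def I_def zero_density_eq_quotient_form[of k n f, OF k(1) False] ..
    qed simp
    finally show "(\<integral>\<^sup>+c. ennreal (cgauss 1 (\<Sum>j\<in>I. c j * a j z) * (cmod (\<Sum>j\<in>I. c j * b j z))\<^sup>2) * indicator ?U z \<partial>?P)
      = ennreal (zero_density f n z) * indicator ?U z" .
  qed
  also have "\<dots> = (\<integral>\<^sup>+z\<in>\<Omega>. ennreal (zero_density f n z) \<partial>lborel)"
  proof (rule nn_integral_cong_AE)
    have "AE z in lborel. z \<notin> {z \<in> \<Omega>. f k z = 0}"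
      by (intro AE_not_in finite_imp_null_set_lborel finZ)
    then show "AE z in lborel. ennreal (zero_density f n z) * indicator ?U z = ennreal (zero_density f n z) * indicator \<Omega> z"
      by (rule eventually_mono) (auto simp: indicator_def)
  qed
  finally show ?thesis .
qed

theorem theorem1:
  fixes M :: "'a measure"
    and n :: nat
    and f :: "nat \<Rightarrow> complex \<Rightarrow> complex"
    and \<alpha> \<beta> :: "nat \<Rightarrow> 'a \<Rightarrow> real"
    and \<Omega> :: "complex set"
  assumes "prob_space M"
    and "\<And>j. j \<le> n \<Longrightarrow> f j holomorphic_on UNIV"
    and "\<And>j x. j \<le> n \<Longrightarrow> f j (complex_of_real x) \<in> \<real>"
    and "prob_space.indep_vars M (\<lambda>_. borel) (case_sum \<alpha> \<beta>) ({..n} <+> {..n})"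
    and "\<And>j. j \<le> n \<Longrightarrow> distributed M lborel (\<alpha> j) std_normal_density"
    and "\<And>j. j \<le> n \<Longrightarrow> distributed M lborel (\<beta> j) std_normal_density"
    and "jordan_region \<Omega>"
    and "\<Omega> \<subseteq> {z. sum_kernel f n z z \<noteq> 0}"
  shows "(\<lambda>\<omega>. zero_count (random_sum f n \<alpha> \<beta> \<omega>) \<Omega>) \<in> borel_measurable M
    \<and> set_integrable lborel \<Omega> (zero_density f n)
    \<and> (\<integral>\<^sup>+\<omega>. zero_count (random_sum f n \<alpha> \<beta> \<omega>) \<Omega> \<partial>M)
        = ennreal (LINT z:\<Omega>|lborel. zero_density f n z)"
proof (cases "\<Omega> = {}")
  case True
  then show ?thesis by (simp add: zero_count_def set_integrable_def set_lebesgue_integral_def)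
next
  case False
  note hol = assms(2)
  interpret prob_space M by (rule assms(1))
  obtain \<gamma> where \<gamma>: "simple_path \<gamma>" "\<Omega> = inside (path_image \<gamma>)"
    using assms(7) by (auto simp: jordan_region_def)
  have \<Omega>: "open \<Omega>" "bounded \<Omega>"
    unfolding \<gamma>(2) using \<gamma>(1)
    by (auto intro!: open_inside bounded_inside closed_simple_path_image bounded_simple_path_image)
  have no_common: "\<exists>j\<le>n. f j z \<noteq> 0" if "z \<in> \<Omega>" for z
    using assms(8) that sum_kernel_eq_0_iff[of f n z] by auto
  obtain k w where k: "k \<le> n" "f k w \<noteq> 0" using False no_common by blast
  have int: "set_integrable lborel \<Omega> (zero_density f n)"
    by (rule set_integrable_zero_density[of n f k w, OF hol k \<Omega>])
  let ?X = "\<lambda>\<omega>. \<lambda>j\<in>{..n}. Complex (\<alpha> j \<omega>) (\<beta> j \<omega>)"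
  let ?N = "\<lambda>c. zero_count (lin_comb f n c) \<Omega>"
  have X: "?X \<in> measurable M (PiM {..n} (\<lambda>_. borel))"
  proof (rule measurable_restrict)
    fix j assume "j \<in> {..n}"
    then show "(\<lambda>\<omega>. Complex (\<alpha> j \<omega>) (\<beta> j \<omega>)) \<in> borel_measurable M"
      using distributed_measurable[OF assms(5)[of j]] distributed_measurable[OF assms(6)[of j]]
      by (intro measurable_Complex) simp_all
  qed
  have N: "?N \<in> borel_measurable (PiM {..n} (\<lambda>_. borel))"
    by (rule borel_measurable_zero_count_PiM[of n f, OF hol \<Omega>])
  have eq: "random_sum f n \<alpha> \<beta> \<omega> = lin_comb f n (?X \<omega>)" for \<omega>
    by (simp add: random_sum_def lin_comb_def fun_eq_iff)
  have meas: "(\<lambda>\<omega>. zero_count (random_sum f n \<alpha> \<beta> \<omega>) \<Omega>) \<in> borel_measurable M"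
    unfolding eq by (rule measurable_compose[OF X N])
  have "(\<integral>\<^sup>+\<omega>. zero_count (random_sum f n \<alpha> \<beta> \<omega>) \<Omega> \<partial>M) = (\<integral>\<^sup>+c. ?N c \<partial>distr M (PiM {..n} (\<lambda>_. borel)) ?X)"
    unfolding eq by (subst nn_integral_distr[OF X]) (use N in simp_all)
  also have "\<dots> = (\<integral>\<^sup>+c. ?N c \<partial>PiM {..n} (\<lambda>_. std_cgauss))"
    by (rule arg_cong[OF distr_complex_normal_family[OF assms(4-6)], of "\<lambda>N. \<integral>\<^sup>+c. ?N c \<partial>N"])
  also have "\<dots> = (\<integral>\<^sup>+z\<in>\<Omega>. ennreal (zero_density f n z) \<partial>lborel)"
    by (rule nn_integral_zero_count_PiM[of n f \<Omega> k w, OF hol \<Omega> no_common k])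
  also have "\<dots> = (\<integral>\<^sup>+z. ennreal (indicator \<Omega> z *\<^sub>R zero_density f n z) \<partial>lborel)"
    by (intro nn_integral_cong) (simp add: indicator_def)
  also have "\<dots> = ennreal (LINT z:\<Omega>|lborel. zero_density f n z)"
    unfolding set_lebesgue_integral_def
    using int by (intro nn_integral_eq_integral) (auto simp: set_integrable_def zero_density_nonneg)
  finally show ?thesis using meas int by blast
qed

end
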